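(* Let $n\ge2$, $d\ge2$, let $m_1,\dots,m_n>0$ and $S=\mathrm{diag}(s_1,\dots,s_d)$ with $s_1>s_2>\dots>s_{d-1}>s_d=1$. Let $q$ be a collinear $S$-balanced configuration. 1. The Morse index of $q$ is at most $(d-1)(n-1)$ and the Morse coindex of $q$ is at least $n-2$. 2. If $q$ is an $s_1$-CSBC, then its Morse index is precisely $(d-1)(n-1)$ and its Morse coindex is precisely $n-2$. Furthermore, if $q$ is an $s_j$-CSBC and $j<d$, then $q$ cannot be a local minimum of $\widehat U$.
   Context: Let $q=(q_1,\dots,q_n)\in(\mathbb R^d)^n$. Set $\mathbb X=\{q\in\mathbb R^{dn}:\sum_i m_iq_i=0\}$, $\Delta=\{q: q_i=q_j \text{ for some } i\neq j\}$, $U(q)=\sum_{i<j}\frac{m_im_j}{|q_i-q_j|}$ on $\mathbb X\setminus\Delta$, $I_S(q)=\sum_i m_i\langle Sq_i,q_i\rangle$, $\mathbb S=\{q\in\mathbb X: I_S(q)=1\}$, $\widehat{\mathbb S}=\mathbb S\setminus\Delta$, $\widehat U=U|_{\widehat{\mathbb S}}$. An $S$-balanced configuration is a $q\in\mathbb X\setminus\Delta$, normalized by $I_S(q)=1$, such that $\nabla_{q_i}U(q)+\lambda m_iSq_i=0$ for all $i$ and some $\lambda>0$; equivalently, a critical point of $\widehat U$. It is collinear (a CSBC) if all $q_i$ lie on a common line through the origin; this line is then a coordinate axis. It is an $s_j$-CSBC if all $q_i\in\mathbb Re_j$, $e_j$ the $j$-th standard basis vector. Morse index and coindex are the numbers of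 negative, respectively positive, eigenvalues (with multiplicity) of the Hessian of $\widehat U$ at $q$ on $T_q\widehat{\mathbb S}$. *)

theory Defs
  imports "HOL-Analysis.Analysis"
begin

text \<open>
  The Hessian of \<open>f\<close> restricted to a submanifold \<open>M\<close>, at a critical point \<open>q\<close> of the restriction:
  the symmetric bilinear form on the tangent space whose value on the diagonal at \<open>v\<close> is the second
  derivative at \<open>0\<close> of \<open>f\<close> along any curve in \<open>M\<close> that leaves \<open>q\<close> with velocity \<open>v\<close>. This number
  depends only on \<open>v\<close> because \<open>q\<close> is critical.
\<close>

definition curve_through ::
  "('a::euclidean_space) set \<Rightarrow> 'a \<Rightarrow> (real \<Rightarrow> 'a) \<Rightarrow> (real \<Rightarrow> 'a) \<Rightarrow> bool" where
  "curve_through M q \<gamma> \<gamma>' \<longleftrightarrow>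
     \<gamma> 0 = q \<and>
     (\<forall>\<^sub>F t in nhds 0. \<gamma> t \<in> M \<and> (\<gamma> has_vector_derivative \<gamma>' t) (at t)) \<and>
     \<gamma>' differentiable (at 0)"

definition tangent_space :: "('a::euclidean_space) set \<Rightarrow> 'a \<Rightarrow> 'a set" where
  "tangent_space M q = {\<gamma>' 0 | \<gamma> \<gamma>'. curve_through M q \<gamma> \<gamma>'}"

definition hessian_quad :: "('a::euclidean_space \<Rightarrow> real) \<Rightarrow> 'a set \<Rightarrow> 'a \<Rightarrow> 'a \<Rightarrow> real" where
  "hessian_quad f M q v =
     (THE c. \<forall>\<gamma> \<gamma>'. curve_through M q \<gamma> \<gamma>' \<and> \<gamma>' 0 = v \<longrightarrow> (deriv ^^ 2) (f \<circ> \<gamma>) 0 = c)"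

definition hessian :: "('a::euclidean_space \<Rightarrow> real) \<Rightarrow> 'a set \<Rightarrow> 'a \<Rightarrow> 'a \<Rightarrow> 'a \<Rightarrow> real" where
  "hessian f M q v w = (hessian_quad f M q (v + w) - hessian_quad f M q (v - w)) / 4"

text \<open>
  Eigenvalues of the bilinear form refer to the Euclidean inner product of the ambient space,
  restricted to the tangent space. As the form is symmetric, the multiplicity of an eigenvalue is
  the dimension of its eigenspace. The sums below are over finite sets, since eigenspaces of
  distinct eigenvalues are orthogonal.
\<close>

definition hessian_eigenspace ::
  "('a::euclidean_space \<Rightarrow> real) \<Rightarrow> 'a set \<Rightarrow> 'a \<Rightarrow> real \<Rightarrow> 'a set" where
  "hessian_eigenspace f M q \<mu> =
     {v \<in> tangent_space M q. \<forall>w \<in> tangent_space M q. hessian f M q v w = \<mu> * (v \<bullet> w)}"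

definition hessian_eigenvalues :: "('a::euclidean_space \<Rightarrow> real) \<Rightarrow> 'a set \<Rightarrow> 'a \<Rightarrow> real set" where
  "hessian_eigenvalues f M q = {\<mu>. \<exists>v \<in> hessian_eigenspace f M q \<mu>. v \<noteq> 0}"

definition morse_index :: "('a::euclidean_space \<Rightarrow> real) \<Rightarrow> 'a set \<Rightarrow> 'a \<Rightarrow> nat" where
  "morse_index f M q =
     (\<Sum>\<mu> \<in> {\<mu> \<in> hessian_eigenvalues f M q. \<mu> < 0}. dim (hessian_eigenspace f M q \<mu>))"

definition morse_coindex :: "('a::euclidean_space \<Rightarrow> real) \<Rightarrow> 'a set \<Rightarrow> 'a \<Rightarrow> nat" where
  "morse_coindex f M q =
     (\<Sum>\<mu> \<in> {\<mu> \<in> hessian_eigenvalues f M q. \<mu> > 0}. dim (hessian_eigenspace f M q \<mu>))"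

definition local_minimum_on :: "('a::topological_space \<Rightarrow> real) \<Rightarrow> 'a set \<Rightarrow> 'a \<Rightarrow> bool" where
  "local_minimum_on f M q \<longleftrightarrow> q \<in> M \<and> (\<forall>\<^sub>F x in at q within M. f q \<le> f x)"


text \<open>
  A configuration of the bodies \<open>i :: 'n\<close> in \<open>\<real>\<^sup>d\<close>, \<open>d = CARD('d)\<close>, is \<open>q :: real^'d^'n\<close>, with positions
  \<open>q $ i\<close>. Both index types are linearly ordered, so they play the roles of \<open>{1..n}\<close> and \<open>{1..d}\<close>.
\<close>

definition diag_matrix :: "('d::finite \<Rightarrow> real) \<Rightarrow> real^'d^'d" where
  "diag_matrix s = (\<chi> i j. if i = j then s i else 0)"

definition centred_configs :: "('n::finite \<Rightarrow> real) \<Rightarrow> (real^'d^'n) set" where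
  "centred_configs m = {q. (\<Sum>i\<in>UNIV. m i *\<^sub>R (q $ i)) = 0}"

definition collisions :: "(real^'d^'n) set" where
  "collisions = {q. \<exists>i j. i \<noteq> j \<and> q $ i = q $ j}"

text \<open>
  Total by the convention \<open>x / 0 = 0\<close>; meaningful only off \<open>collisions\<close>, where it is used.
\<close>

definition potential :: "('n::{finite,linorder} \<Rightarrow> real) \<Rightarrow> real^'d^'n::{finite,linorder} \<Rightarrow> real" where
  "potential m q = (\<Sum>(i, j) \<in> {(i, j). i < j}. m i * m j / norm (q $ i - q $ j))"

definition moment_of_inertia ::
  "('n::finite \<Rightarrow> real) \<Rightarrow> real^'d^'d \<Rightarrow> real^'d^'n \<Rightarrow> real" where
  "moment_of_inertia m S q = (\<Sum>i\<in>UNIV. m i * ((S *v (q $ i)) \<bullet> (q $ i)))"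

definition inertia_sphere :: "('n::finite \<Rightarrow> real) \<Rightarrow> real^'d^'d \<Rightarrow> (real^'d^'n) set" where
  "inertia_sphere m S = {q \<in> centred_configs m. moment_of_inertia m S q = 1}"

definition collision_free_sphere :: "('n::finite \<Rightarrow> real) \<Rightarrow> real^'d^'d \<Rightarrow> (real^'d^'n) set" where
  "collision_free_sphere m S = inertia_sphere m S - collisions"

text \<open>
  \<open>GDERIV\<close> is the full gradient in \<open>\<real>\<^sup>d\<^sup>n\<close>; its \<open>i\<close>-th block \<open>g $ i\<close> is the gradient in \<open>q $ i\<close>.
\<close>

definition balanced_config ::
  "('n::{finite,linorder} \<Rightarrow> real) \<Rightarrow> real^'d^'d \<Rightarrow> real^'d^'n::{finite,linorder} \<Rightarrow> bool" where
  "balanced_config m S q \<longleftrightarrow>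
     q \<in> centred_configs m - collisions \<and> moment_of_inertia m S q = 1 \<and>
     (\<exists>lam>0. \<exists>g. GDERIV (potential m) q :> g \<and>
        (\<forall>i. g $ i + (lam * m i) *\<^sub>R (S *v (q $ i)) = 0))"

definition CSBC :: "('n::{finite,linorder} \<Rightarrow> real) \<Rightarrow> real^'d^'d \<Rightarrow> real^'d^'n::{finite,linorder} \<Rightarrow> bool" where
  "CSBC m S q \<longleftrightarrow> balanced_config m S q \<and> (\<exists>u. u \<noteq> 0 \<and> (\<forall>i. q $ i \<in> span {u}))"

definition axis_CSBC ::
  "('n::{finite,linorder} \<Rightarrow> real) \<Rightarrow> real^'d^'d \<Rightarrow> 'd \<Rightarrow> real^'d^'n::{finite,linorder} \<Rightarrow> bool" where
  "axis_CSBC m S j q \<longleftrightarrow> CSBC m S q \<and> (\<forall>i. q $ i \<in> span {axis j 1})"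

end

theory Submission
  imports Defs
begin

text \<open>
  On the tangent space at a critical point \<open>q\<close>, the Hessian is the second derivative of
  \<open>U + (\<lambda>/2) I\<^sub>S\<close>. If all bodies lie on the axis \<open>k\<close>, with coordinates \<open>x\<^sub>i\<close>, this form splits into
  one form for each coordinate direction. In direction \<open>k\<close> it is positive definite, and the tangent
  space has dimension at least \<open>n - 2\<close> there; this bounds the coindex from below and, since the tangent
  space has dimension \<open>d(n - 1) - 1\<close>, the index from above. In a direction \<open>l \<noteq> k\<close> it is
  \<open>\<lambda> s\<^sub>l \<Sum> m\<^sub>i y\<^sub>i\<^sup>2 - \<Sum>\<^sub>i\<^sub><\<^sub>j m\<^sub>i m\<^sub>j (y\<^sub>i - y\<^sub>j)\<^sup>2 / |x\<^sub>i - x\<^sub>j|\<^sup>3\<close>. For centred \<open>y\<close> the subtracted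
  sum is at least \<open>\<lambda> s\<^sub>k \<Sum> m\<^sub>i y\<^sub>i\<^sup>2\<close>: \<open>x\<close> itself is an eigenvector for \<open>\<lambda> s\<^sub>k\<close>, and because it is
  monotone along the line, this is the least eigenvalue (Conley). Hence the form is negative definite
  when \<open>s\<^sub>l < s\<^sub>k\<close>.
\<close>

section \<open>Eigenspaces of symmetric forms\<close>

text \<open>A zero of a nonnegative form is a minimum, so the first variation of \<open>Q\<close> at
  \<open>x\<close> must vanish. Otherwise a small step along \<open>y\<close> would make
  \<open>Q\<close> negative.\<close>

lemma nonneg_form_null_vector:
  fixes Q :: "'a::real_vector \<Rightarrow> 'a \<Rightarrow> real"
  assumes Q: "bilinear Q" and sym: "\<And>v w. Q v w = Q w v"
    and T: "subspace T" and nonneg: "\<And>y. y \<in> T \<Longrightarrow> Q y y \<ge> 0"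
    and x: "x \<in> T" "Q x x = 0" and y: "y \<in> T"
  shows "Q x y = 0"
proof (rule ccontr)
  assume ne: "Q x y \<noteq> 0"
  \<comment> \<open>The minimizing step would divide by \<open>Q y y\<close>; adding 1 keeps the
    denominator positive when \<open>Q y y = 0\<close>, and the step still decreases
    \<open>Q\<close>.\<close>
  define t where "t = - Q x y / (1 + Q y y)"
  have pos: "1 + Q y y > 0" using nonneg[OF y] by simp
  have mem: "x + t *\<^sub>R y \<in> T"
    using T x y by (simp add: subspace_add subspace_scale)
  have "Q (x + t *\<^sub>R y) (x + t *\<^sub>R y) = 2 * t * Q x y + t\<^sup>2 * Q y y"
    using x(2) sym[of y x]
    by (simp add: bilinear_ladd[OF Q] bilinear_radd[OF Q] bilinear_lmul[OF Q] bilinear_rmul[OF Q]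
        power2_eq_square algebra_simps)
  also have "\<dots> \<le> 2 * t * Q x y + t\<^sup>2 * (1 + Q y y)"
    by (simp add: mult_left_mono)
  also have "\<dots> = - (Q x y)\<^sup>2 / (1 + Q y y)"
  proof -
    have "t * (1 + Q y y) = - Q x y" using pos unfolding t_def by simp
    then have "2 * t * Q x y + t\<^sup>2 * (1 + Q y y) = t * Q x y"
      by (simp add: power2_eq_square mult.assoc)
    then show ?thesis unfolding t_def by (simp add: power2_eq_square)
  qed
  also have "\<dots> < 0" using ne pos by simp
  finally show False using nonneg[OF mem] by simp
qed

text \<open>The Rayleigh quotient of \<open>h\<close> over \<open>g\<close> attains its minimum
  \<open>\<mu>\<close> on the compact unit sphere of \<open>T\<close>. There
  \<open>h - \<mu> g\<close> is nonnegative with null vector \<open>x\<close>, which gives the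
  eigenvalue equation. The lemma serves with the Euclidean product as \<open>g\<close> and with the
  mass form as \<open>g\<close>.\<close>

lemma minimal_generalized_eigenvector:
  fixes h g :: "'a::euclidean_space \<Rightarrow> 'a \<Rightarrow> real"
  assumes h: "bilinear h" "\<And>v w. h v w = h w v"
    and g: "bilinear g" "\<And>v w. g v w = g w v"
    and pos: "\<And>v. v \<in> T \<Longrightarrow> v \<noteq> 0 \<Longrightarrow> g v v > 0"
    and T: "subspace T" and y0: "y0 \<in> T" "y0 \<noteq> 0"
  obtains x \<mu> where "x \<in> T" "x \<noteq> 0" "\<And>y. y \<in> T \<Longrightarrow> h x y = \<mu> * g x y"
    "\<And>y. y \<in> T \<Longrightarrow> h y y \<ge> \<mu> * g y y"
proof -
  let ?K = "sphere 0 1 \<inter> T"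
  have K: "compact ?K" using T by (intro compact_Int_closed closed_subspace) auto
  have "y0 /\<^sub>R norm y0 \<in> ?K" using y0 T by (auto intro: subspace_scale)
  then have ne: "?K \<noteq> {}" by blast
  have ch: "continuous_on ?K (\<lambda>v. h v v)" "continuous_on ?K (\<lambda>v. g v v)"
    by (rule bilinear_continuous_on_compose[OF continuous_on_id continuous_on_id h(1)])
      (rule bilinear_continuous_on_compose[OF continuous_on_id continuous_on_id g(1)])
  have "continuous_on ?K (\<lambda>v. h v v / g v v)"
  proof (intro continuous_on_divide ch ballI)
    fix v assume v: "v \<in> ?K"
    then have "v \<noteq> 0" by force
    then show "g v v \<noteq> 0" using pos[of v] v by simp
  qed
  then obtain x where x: "x \<in> ?K" and min: "\<And>y. y \<in> ?K \<Longrightarrow> h x x / g x x \<le> h y y / g y y"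
    using continuous_attains_inf[OF K ne] by blast
  define \<mu> where "\<mu> = h x x / g x x"
  have x': "x \<in> T" "x \<noteq> 0" using x by auto
  have ge: "h y y \<ge> \<mu> * g y y" if "y \<in> T" for y
  proof (cases "y = 0")
    case True
    then show ?thesis by (simp add: bilinear_lzero[OF h(1)] bilinear_lzero[OF g(1)])
  next
    case False
    have "y /\<^sub>R norm y \<in> ?K" using that False T by (auto intro: subspace_scale)
    from min[OF this] have "\<mu> \<le> h y y / g y y"
      using False by (simp add: \<mu>_def bilinear_lmul[OF h(1)] bilinear_rmul[OF h(1)]
          bilinear_lmul[OF g(1)] bilinear_rmul[OF g(1)])
    then show ?thesis using pos[OF that False] by (simp add: field_simps)
  qed
  define Q where "Q = (\<lambda>v w. h v w - \<mu> * g v w)"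
  have Q: "bilinear Q"
    using h(1) g(1) unfolding bilinear_def Q_def
    by (auto intro!: linear_compose_sub simp: linear_iff algebra_simps)
  have "Q x y = 0" if "y \<in> T" for y
  proof (rule nonneg_form_null_vector[OF Q _ T _ x'(1) _ that])
    show "Q x x = 0" using pos[OF x'] by (simp add: Q_def \<mu>_def)
  qed (use ge h(2) g(2) in \<open>auto simp: Q_def\<close>)
  then have "h x y = \<mu> * g x y" if "y \<in> T" for y using that by (simp add: Q_def)
  with x' ge show thesis using that by blast
qed

text \<open>Weak form of the eigenvalue equation, tested only against \<open>T\<close>; it has the
  same shape as \<open>hessian_eigenspace\<close>, for an arbitrary form.\<close>

definition form_eigenspace :: "('a::euclidean_space \<Rightarrow> 'a \<Rightarrow> real) \<Rightarrow> 'a set \<Rightarrow> real \<Rightarrow> 'a set" where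
  "form_eigenspace h T \<mu> = {v \<in> T. \<forall>w\<in>T. h v w = \<mu> * (v \<bullet> w)}"

lemma form_eigenspace_orthogonal:
  assumes "\<And>v w. h v w = h w v" "v \<in> form_eigenspace h T \<mu>" "w \<in> form_eigenspace h T \<nu>" "\<mu> \<noteq> \<nu>"
  shows "v \<bullet> w = 0"
proof -
  have "\<mu> * (v \<bullet> w) = \<nu> * (v \<bullet> w)"
    using assms(1)[of v w] assms(2,3) by (auto simp: form_eigenspace_def inner_commute)
  then show ?thesis using \<open>\<mu> \<noteq> \<nu>\<close> by simp
qed

text \<open>One eigenvector chosen for each eigenvalue gives an orthogonal, hence independent,
  family.\<close>

lemma finite_form_eigenvalues:
  fixes h :: "'a::euclidean_space \<Rightarrow> 'a \<Rightarrow> real"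
  assumes sym: "\<And>v w. h v w = h w v"
  shows "finite {\<mu>. \<exists>v\<in>form_eigenspace h T \<mu>. v \<noteq> 0}"
proof -
  let ?K = "{\<mu>. \<exists>v\<in>form_eigenspace h T \<mu>. v \<noteq> 0}"
  obtain e where e: "\<And>\<mu>. \<mu> \<in> ?K \<Longrightarrow> e \<mu> \<in> form_eigenspace h T \<mu> \<and> e \<mu> \<noteq> 0"
    using bchoice[of ?K "\<lambda>\<mu> v. v \<in> form_eigenspace h T \<mu> \<and> v \<noteq> 0"] by blast
  have orth: "e \<mu> \<bullet> e \<nu> = 0" if "\<mu> \<in> ?K" "\<nu> \<in> ?K" "\<mu> \<noteq> \<nu>" for \<mu> \<nu>
    using form_eigenspace_orthogonal[of h, OF sym] e that by blast
  have inj: "inj_on e ?K"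
  proof (rule inj_onI)
    fix \<mu> \<nu> assume *: "\<mu> \<in> ?K" "\<nu> \<in> ?K" "e \<mu> = e \<nu>"
    show "\<mu> = \<nu>"
    proof (rule ccontr)
      assume "\<mu> \<noteq> \<nu>"
      then have "e \<mu> \<bullet> e \<mu> = 0" using orth[OF *(1,2)] *(3) by simp
      then show False using e[OF *(1)] by simp
    qed
  qed
  have "pairwise orthogonal (e ` ?K)"
    using orth by (auto simp: pairwise_def orthogonal_def)
  moreover have "0 \<notin> e ` ?K" using e by (metis (no_types, lifting) imageE)
  ultimately have "independent (e ` ?K)" by (rule pairwise_orthogonal_independent)
  then have "finite (e ` ?K)" by (rule independent_imp_finite)
  then show ?thesis using finite_imageD inj by blast
qed

lemma dim_Union_orthogonal:
  fixes E :: "'i \<Rightarrow> 'a::euclidean_space set"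
  assumes "finite K"
    and "\<And>i j v w. i \<in> K \<Longrightarrow> j \<in> K \<Longrightarrow> i \<noteq> j \<Longrightarrow> v \<in> E i \<Longrightarrow> w \<in> E j \<Longrightarrow> v \<bullet> w = 0"
  shows "dim (\<Union>i\<in>K. E i) = (\<Sum>i\<in>K. dim (E i))"
  using assms
proof (induction K)
  case (insert i K)
  have "dim (E i \<union> (\<Union>j\<in>K. E j)) = dim (E i) + dim (\<Union>j\<in>K. E j)"
    by (rule dim_orthogonal_sum) (use insert in blast)
  moreover have "dim (\<Union>j\<in>K. E j) = (\<Sum>j\<in>K. dim (E j))"
    by (rule insert.IH) (use insert.prems in blast)
  ultimately show ?case using insert.hyps by simp
qed simp

text \<open>Half of Sylvester's law of inertia. A larger \<open>W\<close> would contain a nonzero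
  vector orthogonal to all negative eigenspaces, and the least eigenvalue of \<open>h\<close> on
  their complement in \<open>T\<close> would then be negative. A single minimizing eigenvector
  suffices for the contradiction.\<close>

lemma dim_definite_le_eigenspaces:
  fixes h :: "'a::euclidean_space \<Rightarrow> 'a \<Rightarrow> real"
  assumes h: "bilinear h" and sym: "\<And>v w. h v w = h w v" and T: "subspace T"
    and W: "subspace W" "W \<subseteq> T" and neg: "\<And>v. v \<in> W \<Longrightarrow> v \<noteq> 0 \<Longrightarrow> h v v < 0"
  shows "dim W \<le> dim (\<Union>\<mu>\<in>{\<mu>. \<mu> < 0}. form_eigenspace h T \<mu>)"
proof (rule ccontr)
  let ?N = "span (\<Union>\<mu>\<in>{\<mu>. \<mu> < 0}. form_eigenspace h T \<mu>)"
  let ?P = "{y \<in> T. \<forall>n\<in>?N. n \<bullet> y = 0}"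
  assume "\<not> ?thesis"
  then have dW: "dim ?N < dim W" by simp
  have NT: "?N \<subseteq> T"
    by (rule span_minimal[OF _ T]) (auto simp: form_eigenspace_def)
  \<comment> \<open>The complement is taken in the whole space, where its dimension is
    \<open>DIM('a) - dim ?N\<close>; with \<open>dim W > dim ?N\<close> it must meet
    \<open>W\<close> outside 0.\<close>
  have "\<exists>w\<in>W. w \<noteq> 0 \<and> (\<forall>n\<in>?N. n \<bullet> w = 0)"
  proof -
    let ?C = "{w. \<forall>n\<in>?N. n \<bullet> w = 0}"
    have C: "dim ?C + dim ?N = DIM('a)"
      using dim_subspace_orthogonal_to_vectors[of ?N UNIV]
      by (simp add: orthogonal_def subspace_UNIV)
    have sC: "subspace ?C" by (auto simp: subspace_def inner_add_right)
    have "dim (W \<inter> ?C) + dim {x + y |x y. x \<in> W \<and> y \<in> ?C} = dim W + dim ?C"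
      using dim_sums_Int[OF W(1) sC] by simp
    moreover have "dim {x + y |x y. x \<in> W \<and> y \<in> ?C} \<le> DIM('a)" by (rule dim_subset_UNIV)
    ultimately have "dim (W \<inter> ?C) > 0" using C dW by linarith
    then have "\<not> W \<inter> ?C \<subseteq> {0}" using dim_eq_0[of "W \<inter> ?C"] by linarith
    then obtain w where "w \<in> W \<inter> ?C" "w \<noteq> 0" by auto
    then show ?thesis by (intro bexI[of _ w]) simp_all
  qed
  then obtain w where w0: "w \<in> W" "w \<noteq> 0" "\<forall>n\<in>?N. n \<bullet> w = 0" by auto
  have w: "w \<in> W" "w \<noteq> 0" "w \<in> ?P" using w0 W(2) by auto
  have P: "subspace ?P"
    using T by (auto simp: subspace_def inner_add_right)
  have bil: "bilinear ((\<bullet>) :: 'a \<Rightarrow> 'a \<Rightarrow> real)"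
    by (simp add: bilinear_conv_bounded_bilinear bounded_bilinear_inner)
  \<comment> \<open>The minimizer on the orthogonal complement of \<open>?N\<close> is an eigenvector on all of \<open>T\<close>, since \<open>?N\<close> is
    invariant; if its eigenvalue were negative it would lie in \<open>?N\<close>.\<close>
  obtain x \<mu> where x: "x \<in> ?P" "x \<noteq> 0" "\<And>y. y \<in> ?P \<Longrightarrow> h x y = \<mu> * (x \<bullet> y)"
    "\<And>y. y \<in> ?P \<Longrightarrow> h y y \<ge> \<mu> * (y \<bullet> y)"
    by (rule minimal_generalized_eigenvector[of h "(\<bullet>)" ?P w, OF h sym bil inner_commute _ P w(3,2)])
      (simp, blast)
  have hN: "h x n = 0" if "n \<in> ?N" for n
    using that
  proof (induction rule: span_induct)
    case base
    show ?case using h unfolding bilinear_def by (auto simp: subspace_def linear_iff bilinear_rzero[OF h])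
  next
    case (step n)
    then obtain \<nu> where n: "n \<in> form_eigenspace h T \<nu>" "\<nu> < 0" by blast
    have "n \<in> ?N" using n by (auto intro: span_base)
    then have "n \<bullet> x = 0" using x(1) by blast
    then show ?case using n x(1) sym[of x n] by (simp add: form_eigenspace_def)
  qed
  have "h x y = \<mu> * (x \<bullet> y)" if "y \<in> T" for y
  proof -
    obtain a b where ab: "a \<in> ?N" "\<And>c. c \<in> ?N \<Longrightarrow> orthogonal b c" "y = a + b"
      using orthogonal_subspace_decomp_exists[of ?N y, unfolded span_span] by blast
    have "a \<in> T" using ab(1) NT by blast
    then have "b \<in> T" using subspace_diff[OF T that, of a] ab(3) by simp
    then have "b \<in> ?P" using ab(2) by (simp add: orthogonal_def inner_commute)
    moreover have "x \<bullet> a = 0" using x(1) ab(1) by (simp add: inner_commute)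
    ultimately show ?thesis using hN[OF ab(1)] x(3)[of b]
      by (simp add: ab(3) bilinear_radd[OF h] inner_add_right)
  qed
  then have ex: "x \<in> form_eigenspace h T \<mu>" using x(1) by (simp add: form_eigenspace_def)
  have "\<mu> * (w \<bullet> w) < 0" using neg[OF w(1,2)] x(4)[OF w(3)] by linarith
  then have "\<mu> < 0" using inner_ge_zero[of w] by (metis mult_nonneg_nonneg not_le)
  then have "x \<in> ?N" using ex by (auto intro: span_base)
  then have "x \<bullet> x = 0" using x(1) by blast
  then show False using x(2) by simp
qed

text \<open>Turns the sum defining index or coindex into the dimension of one set. Orthogonality
  makes the dimensions add up, and values \<open>\<mu>\<close> that are not eigenvalues contribute
  at most the zero vector.\<close>

lemma sum_dim_form_eigenspaces:
  fixes h :: "'a::euclidean_space \<Rightarrow> 'a \<Rightarrow> real"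
  assumes sym: "\<And>v w. h v w = h w v"
  shows "(\<Sum>\<mu> \<in> {\<mu>. (\<exists>v\<in>form_eigenspace h T \<mu>. v \<noteq> 0) \<and> P \<mu>}. dim (form_eigenspace h T \<mu>))
    = dim (\<Union>\<mu>\<in>{\<mu>. P \<mu>}. form_eigenspace h T \<mu>)"
proof -
  let ?K = "{\<mu>. (\<exists>v\<in>form_eigenspace h T \<mu>. v \<noteq> 0) \<and> P \<mu>}"
  have "dim (\<Union>\<mu>\<in>?K. form_eigenspace h T \<mu>) = (\<Sum>\<mu>\<in>?K. dim (form_eigenspace h T \<mu>))"
  proof (rule dim_Union_orthogonal)
    show "finite ?K"
      by (rule finite_subset[OF _ finite_form_eigenvalues[of h T, OF sym]]) blast
  qed (rule form_eigenspace_orthogonal[of h, OF sym])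
  moreover have "dim (\<Union>\<mu>\<in>?K. form_eigenspace h T \<mu>) = dim (\<Union>\<mu>\<in>{\<mu>. P \<mu>}. form_eigenspace h T \<mu>)"
  proof (rule antisym)
    show "dim (\<Union>\<mu>\<in>?K. form_eigenspace h T \<mu>) \<le> dim (\<Union>\<mu>\<in>{\<mu>. P \<mu>}. form_eigenspace h T \<mu>)"
      by (rule dim_subset) blast
    have "(\<Union>\<mu>\<in>{\<mu>. P \<mu>}. form_eigenspace h T \<mu>) \<subseteq> span (\<Union>\<mu>\<in>?K. form_eigenspace h T \<mu>)"
    proof
      fix v assume "v \<in> (\<Union>\<mu>\<in>{\<mu>. P \<mu>}. form_eigenspace h T \<mu>)"
      then obtain \<mu> where \<mu>: "P \<mu>" "v \<in> form_eigenspace h T \<mu>" by auto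
      show "v \<in> span (\<Union>\<mu>\<in>?K. form_eigenspace h T \<mu>)"
      proof (cases "v = 0")
        case True
        show ?thesis unfolding True by (rule span_0)
      next
        case False
        with \<mu> have "\<mu> \<in> ?K" by blast
        then show ?thesis using \<mu>(2) by (intro span_base UN_I)
      qed
    qed
    from dim_subset[OF this]
    show "dim (\<Union>\<mu>\<in>{\<mu>. P \<mu>}. form_eigenspace h T \<mu>) \<le> dim (\<Union>\<mu>\<in>?K. form_eigenspace h T \<mu>)"
      by (simp only: dim_span)
  qed
  ultimately show ?thesis by simp
qed

text \<open>The negative case for \<open>- h\<close>, whose eigenvalues have the opposite
  sign.\<close>

lemma dim_definite_le_eigenspaces_pos:
  fixes h :: "'a::euclidean_space \<Rightarrow> 'a \<Rightarrow> real"
  assumes h: "bilinear h" and sym: "\<And>v w. h v w = h w v" and T: "subspace T"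
    and W: "subspace W" "W \<subseteq> T" and pos: "\<And>v. v \<in> W \<Longrightarrow> v \<noteq> 0 \<Longrightarrow> h v v > 0"
  shows "dim W \<le> dim (\<Union>\<mu>\<in>{\<mu>. \<mu> > 0}. form_eigenspace h T \<mu>)"
proof -
  let ?h = "\<lambda>v w. - h v w"
  have "bilinear ?h" using h unfolding bilinear_def by (auto intro: linear_compose_neg)
  then have "dim W \<le> dim (\<Union>\<mu>\<in>{\<mu>. \<mu> < 0}. form_eigenspace ?h T \<mu>)"
    by (rule dim_definite_le_eigenspaces) (use assms in auto)
  moreover have eq: "form_eigenspace ?h T \<mu> = form_eigenspace h T (- \<mu>)" for \<mu>
  proof -
    have "- h v w = \<mu> * (v \<bullet> w) \<longleftrightarrow> h v w = - \<mu> * (v \<bullet> w)" for v w by auto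
    then show ?thesis unfolding form_eigenspace_def by simp
  qed
  then have "(\<Union>\<mu>\<in>{\<mu>. \<mu> < 0}. form_eigenspace ?h T \<mu>) = (\<Union>\<mu>\<in>{\<mu>. \<mu> > 0}. form_eigenspace h T \<mu>)"
  proof (intro set_eqI iffI)
    fix v
    assume "v \<in> (\<Union>\<mu>\<in>{\<mu>. \<mu> > 0}. form_eigenspace h T \<mu>)"
    then obtain \<mu> where "v \<in> form_eigenspace h T \<mu>" "\<mu> > 0" by auto
    then show "v \<in> (\<Union>\<mu>\<in>{\<mu>. \<mu> < 0}. form_eigenspace ?h T \<mu>)"
      using eq by (intro UN_I[of "- \<mu>"]) auto
  next
    fix v
    assume "v \<in> (\<Union>\<mu>\<in>{\<mu>. \<mu> < 0}. form_eigenspace ?h T \<mu>)"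
    then obtain \<mu> where "v \<in> form_eigenspace ?h T \<mu>" "\<mu> < 0" by auto
    then show "v \<in> (\<Union>\<mu>\<in>{\<mu>. \<mu> > 0}. form_eigenspace h T \<mu>)"
      using eq by (intro UN_I[of "- \<mu>"]) auto
  qed
  ultimately show ?thesis by simp
qed

text \<open>Only an inequality, since the kernel of the form is left out. It turns a lower bound on
  the coindex into an upper bound on the index.\<close>

lemma dim_eigenspaces_neg_pos_le:
  fixes h :: "'a::euclidean_space \<Rightarrow> 'a \<Rightarrow> real"
  assumes sym: "\<And>v w. h v w = h w v"
  shows "dim (\<Union>\<mu>\<in>{\<mu>. \<mu> < 0}. form_eigenspace h T \<mu>)
    + dim (\<Union>\<mu>\<in>{\<mu>. \<mu> > 0}. form_eigenspace h T \<mu>) \<le> dim T"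
proof -
  have "dim (\<Union>\<mu>\<in>{\<mu>. \<mu> < 0}. form_eigenspace h T \<mu>)
    + dim (\<Union>\<mu>\<in>{\<mu>. \<mu> > 0}. form_eigenspace h T \<mu>)
    = dim ((\<Union>\<mu>\<in>{\<mu>. \<mu> < 0}. form_eigenspace h T \<mu>) \<union> (\<Union>\<mu>\<in>{\<mu>. \<mu> > 0}. form_eigenspace h T \<mu>))"
  proof (rule dim_orthogonal_sum[symmetric])
    fix x y
    assume "x \<in> (\<Union>\<mu>\<in>{\<mu>. \<mu> < 0}. form_eigenspace h T \<mu>)"
      and "y \<in> (\<Union>\<mu>\<in>{\<mu>. \<mu> > 0}. form_eigenspace h T \<mu>)"
    then obtain \<mu> \<nu> where "x \<in> form_eigenspace h T \<mu>" "\<mu> < 0" "y \<in> form_eigenspace h T \<nu>" "\<nu> > 0"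
      by auto
    then show "x \<bullet> y = 0" by (intro form_eigenspace_orthogonal[of h, OF sym]) auto
  qed
  also have "\<dots> \<le> dim T"
    by (rule dim_subset) (auto simp: form_eigenspace_def)
  finally show ?thesis .
qed

section \<open>The spectral gap on a line\<close>

text \<open>Discrete summation by parts: exchanging the summation indices moves the part with
  \<open>y j\<close> onto \<open>y i\<close>. It turns pairwise interactions into the total force on
  each body.\<close>

lemma sum_antisymmetric_pairs:
  fixes c :: "'n::finite \<Rightarrow> 'n \<Rightarrow> 'a::real_inner"
  assumes "\<And>i j. c j i = - c i j"
  shows "(\<Sum>i\<in>UNIV. \<Sum>j\<in>UNIV. c i j \<bullet> (y i - y j)) = 2 * (\<Sum>i\<in>UNIV. \<Sum>j\<in>UNIV. c i j \<bullet> y i)"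
proof -
  have "(\<Sum>i\<in>UNIV. \<Sum>j\<in>UNIV. c i j \<bullet> y j) = (\<Sum>j\<in>UNIV. \<Sum>i\<in>UNIV. c i j \<bullet> y j)"
    by (rule sum.swap)
  also have "\<dots> = - (\<Sum>i\<in>UNIV. \<Sum>j\<in>UNIV. c i j \<bullet> y i)"
    unfolding sum_negf[symmetric] by (intro sum.cong refl) (metis assms inner_minus_left)
  finally show ?thesis by (simp add: inner_diff_right sum_subtractf)
qed

text \<open>
  Let \<open>L\<close> be the largest difference quotient of \<open>v\<close> over \<open>x\<close>, attained at \<open>a\<close> and \<open>b\<close>. Then
  \<open>\<eta> = L x - v\<close> is nondecreasing in \<open>x\<close> and takes the same value at \<open>a\<close> and \<open>b\<close>. As the weights
  decrease with the distance, every term of the operator applied to \<open>\<eta>\<close> is at most as large at \<open>b\<close>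
  as at \<open>a\<close>, while \<open>\<eta>\<close> is a combination of two eigenvectors.
\<close>

lemma eigenvalue_ge_of_monotone_eigenvector:
  fixes m x v :: "'n::finite \<Rightarrow> real"
  assumes m: "\<And>i. m i > 0" and inj: "inj x"
    and x: "\<And>i. (\<Sum>j\<in>UNIV. m j * (x i - x j) / \<bar>x i - x j\<bar> ^ 3) = \<omega> * x i"
    and v: "\<And>i. (\<Sum>j\<in>UNIV. m j * (v i - v j) / \<bar>x i - x j\<bar> ^ 3) = \<mu> * v i"
    and ab0: "x a0 < x b0" "v a0 < v b0"
  shows "\<omega> \<le> \<mu>"
proof -
  let ?P = "{(a, b). x a < x b}"
  let ?f = "\<lambda>(a, b). (v b - v a) / (x b - x a)"
  have "Max (?f ` ?P) \<in> ?f ` ?P" by (rule Max_in) (use ab0 in auto)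
  then obtain a b where ab: "x a < x b" and "Max (?f ` ?P) = (v b - v a) / (x b - x a)" by auto
  moreover define L where "L = (v b - v a) / (x b - x a)"
  ultimately have max: "?f p \<le> L" if "p \<in> ?P" for p
    using Max_ge[of "?f ` ?P" "?f p"] that by simp
  have "0 < (v b0 - v a0) / (x b0 - x a0)" using ab0 by simp
  also have "\<dots> \<le> L" using max[of "(a0, b0)"] ab0 by simp
  finally have L: "L > 0" .
  define \<eta> where "\<eta> = (\<lambda>i. L * x i - v i)"
  have mono: "\<eta> i \<le> \<eta> j" if "x i < x j" for i j
    using max[of "(i, j)"] that by (simp add: \<eta>_def field_simps)
  have eq: "\<eta> a = \<eta> b"
    using ab by (simp add: \<eta>_def L_def field_simps)
  have inv_mono: "1 / \<bar>s\<bar> ^ 3 \<le> 1 / \<bar>t\<bar> ^ 3" if "\<bar>t\<bar> \<le> \<bar>s\<bar>" "t \<noteq> 0" for s t :: real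
    using that by (intro divide_left_mono power_mono) auto
  define D where "D = (\<lambda>i. \<Sum>j\<in>UNIV. m j * (\<eta> i - \<eta> j) / \<bar>x i - x j\<bar> ^ 3)"
  have D: "D i = L * \<omega> * x i - \<mu> * v i" for i
  proof -
    have "D i = L * (\<Sum>j\<in>UNIV. m j * (x i - x j) / \<bar>x i - x j\<bar> ^ 3)
        - (\<Sum>j\<in>UNIV. m j * (v i - v j) / \<bar>x i - x j\<bar> ^ 3)"
      unfolding D_def \<eta>_def sum_distrib_left sum_subtractf[symmetric]
      by (intro sum.cong refl) (simp add: algebra_simps diff_divide_distrib add_divide_distrib)
    then show ?thesis unfolding x v by simp
  qed
  have "D b \<le> D a"
    unfolding D_def
  proof (rule sum_mono)
    fix j
    show "m j * (\<eta> b - \<eta> j) / \<bar>x b - x j\<bar> ^ 3 \<le> m j * (\<eta> a - \<eta> j) / \<bar>x a - x j\<bar> ^ 3"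
    proof -
      \<comment> \<open>Both terms carry the factor \<open>\<eta> b - \<eta> j\<close>, because
        \<open>\<eta> a = \<eta> b\<close>. It vanishes for \<open>x j\<close> in the closed
        interval from \<open>x a\<close> to \<open>x b\<close>. To the left it is nonnegative and
        \<open>b\<close> is farther away than \<open>a\<close>; to the right it is nonpositive and
        \<open>b\<close> is nearer.\<close>
      consider "x j = x a" | "x j = x b" | "x j < x a" | "x a < x j" "x j < x b" | "x b < x j"
        by linarith
      then have "(\<eta> b - \<eta> j) * (1 / \<bar>x b - x j\<bar> ^ 3) \<le> (\<eta> b - \<eta> j) * (1 / \<bar>x a - x j\<bar> ^ 3)"
      proof cases
        case 1
        then have "j = a" using inj by (simp add: inj_eq)
        then show ?thesis using eq by simp
      next
        case 2
        then have "j = b" using inj by (simp add: inj_eq)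
        then show ?thesis by simp
      next
        case 3
        then show ?thesis using mono[of j b] ab by (intro mult_left_mono inv_mono) auto
      next
        case 4
        then have "\<eta> j = \<eta> b" using mono[of a j] mono[of j b] eq by simp
        then show ?thesis by simp
      next
        case 5
        then show ?thesis using mono[of b j] ab by (intro mult_left_mono_neg inv_mono) auto
      qed
      from mult_left_mono[OF this, of "m j"] m[of j] show ?thesis by (simp add: eq mult.assoc)
    qed
  qed
  \<comment> \<open>The difference quotient of \<open>v\<close> between \<open>a\<close> and
    \<open>b\<close> is exactly \<open>L\<close>, so both eigenvalues end up with the same positive
    factor.\<close>
  moreover have "D b - D a = L * (\<omega> - \<mu>) * (x b - x a)"
  proof -
    have "v b - v a = L * (x b - x a)" using ab by (simp add: L_def)
    then have "\<mu> * v b - \<mu> * v a = \<mu> * (L * (x b - x a))" by (simp flip: right_diff_distrib)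
    then show ?thesis unfolding D by (simp add: algebra_simps)
  qed
  ultimately have "L * (\<omega> - \<mu>) * (x b - x a) \<le> 0" by simp
  then show ?thesis using L ab by (simp add: mult_le_0_iff)
qed

lemma bilinear_sum_forms:
  fixes B :: "'i \<Rightarrow> 'a::real_vector \<Rightarrow> 'a \<Rightarrow> real"
  assumes "\<And>i. i \<in> I \<Longrightarrow> bilinear (B i)"
  shows "bilinear (\<lambda>v w. \<Sum>i\<in>I. B i v w)"
  using assms unfolding bilinear_def by (auto intro!: linear_compose_sum)

lemma bilinear_add_forms:
  fixes B C :: "'a::real_vector \<Rightarrow> 'a \<Rightarrow> real"
  assumes "bilinear B" "bilinear C"
  shows "bilinear (\<lambda>v w. B v w + C v w)"
  using assms unfolding bilinear_def by (auto intro!: linear_compose_add)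

lemma bilinear_scaled_inner:
  fixes f g :: "'a::real_vector \<Rightarrow> 'b::real_inner"
  assumes f: "linear f" and g: "linear g"
  shows "bilinear (\<lambda>v w. c * (f v \<bullet> g w))"
  unfolding bilinear_def linear_iff
  by (simp add: linear_add[OF f] linear_add[OF g] linear_scale[OF f] linear_scale[OF g]
      inner_add_left inner_add_right algebra_simps)

lemma linear_vec_nth: "linear (\<lambda>v. v $ i)"
  by (simp add: linear_iff)

lemma linear_vec_nth_diff: "linear (\<lambda>v. v $ i - v $ j)"
  by (simp add: linear_iff algebra_simps)

text \<open>The right-hand side is the quadratic form \<open>h\<close>. On centred vectors it is at
  least \<open>\<mu>\<close> times the mass form \<open>g\<close>, where \<open>\<mu>\<close> is the
  least eigenvalue of \<open>h\<close> relative to \<open>g\<close>; the comparison with the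
  monotone eigenvector \<open>x\<close> gives \<open>\<omega> \<le> \<mu>\<close>.\<close>

lemma collinear_spectral_gap:
  fixes m x y :: "'n::finite \<Rightarrow> real"
  assumes m: "\<And>i. m i > 0" and inj: "inj x"
    and x: "\<And>i. (\<Sum>j\<in>UNIV. m j * (x i - x j) / \<bar>x i - x j\<bar> ^ 3) = \<omega> * x i"
    and y: "(\<Sum>i\<in>UNIV. m i * y i) = 0"
  shows "\<omega> * (\<Sum>i\<in>UNIV. m i * (y i)\<^sup>2)
    \<le> (\<Sum>i\<in>UNIV. \<Sum>j\<in>UNIV. m i * m j / \<bar>x i - x j\<bar> ^ 3 * (y i - y j)\<^sup>2) / 2"
proof (cases "\<forall>i. y i = 0")
  case True
  then show ?thesis by simp
next
  case False
  define c where "c = (\<lambda>i j. m i * m j / \<bar>x i - x j\<bar> ^ 3)"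
  define h where "h = (\<lambda>v w :: real^'n. \<Sum>i\<in>UNIV. \<Sum>j\<in>UNIV. c i j / 2 * ((v$i - v$j) \<bullet> (w$i - w$j)))"
  define g where "g = (\<lambda>v w :: real^'n. \<Sum>i\<in>UNIV. m i * (v$i \<bullet> w$i))"
  define T where "T = {v :: real^'n. (\<Sum>i\<in>UNIV. m i * v$i) = 0}"
  have c_sym: "c i j = c j i" for i j
    by (simp add: c_def abs_minus_commute mult.commute)
  have h: "bilinear h" unfolding h_def
    by (intro bilinear_sum_forms bilinear_scaled_inner linear_vec_nth_diff)
  have g: "bilinear g" unfolding g_def
    by (intro bilinear_sum_forms bilinear_scaled_inner linear_vec_nth)
  have T: "subspace T"
    unfolding T_def subspace_def
    by (simp add: algebra_simps sum.distrib flip: sum_distrib_left)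
  have hsym: "h v w = h w v" and gsym: "g v w = g w v" for v w
    by (simp_all add: h_def g_def mult.commute)
  have gpos: "g v v > 0" if "v \<noteq> 0" for v
  proof -
    obtain i where "v $ i \<noteq> 0" using \<open>v \<noteq> 0\<close> by (metis vec_eq_iff zero_index)
    moreover have "0 \<le> m k * (v $ k \<bullet> v $ k)" for k using m[of k] by simp
    ultimately show ?thesis unfolding g_def using m[of i]
      by (intro sum_pos2[of _ i]) (auto simp: zero_less_mult_iff linorder_neq_iff)
  qed
  let ?y = "\<chi> i. y i"
  have "?y \<in> T" using y by (simp add: T_def)
  moreover have "?y \<noteq> 0" using False by (simp add: vec_eq_iff)
  ultimately obtain v \<mu> where v: "v \<in> T" "v \<noteq> 0"
    and ev: "\<And>w. w \<in> T \<Longrightarrow> h v w = \<mu> * g v w" and min: "\<And>w. w \<in> T \<Longrightarrow> h w w \<ge> \<mu> * g w w"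
    using minimal_generalized_eigenvector[of h g T ?y, OF h hsym g gsym gpos T] by metis
  have M: "(\<Sum>i\<in>UNIV. m i) > 0" using m by (intro sum_pos) auto
  \<comment> \<open>Both forms vanish when one argument is constant, so the eigenvalue equation extends from \<open>T\<close>.\<close>
  have ev_all: "h v w = \<mu> * g v w" for w
  proof -
    define t where "t = (\<Sum>i\<in>UNIV. m i * w$i) / (\<Sum>i\<in>UNIV. m i)"
    have "(\<Sum>i\<in>UNIV. m i) * t = (\<Sum>i\<in>UNIV. m i * w$i)" using M by (simp add: t_def)
    then have "w - (\<chi> i. t) \<in> T"
      by (simp add: T_def right_diff_distrib sum_subtractf flip: sum_distrib_right)
    moreover have "h v (w - (\<chi> i. t)) = h v w" by (simp add: h_def)
    moreover have "g v (w - (\<chi> i. t)) = g v w"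
    proof -
      have "(\<Sum>i\<in>UNIV. m i * (v$i \<bullet> t)) = (\<Sum>i\<in>UNIV. m i * v$i) * t"
        by (simp add: sum_distrib_right mult.assoc)
      also have "\<dots> = 0" using v(1) by (simp add: T_def)
      finally show ?thesis by (simp add: g_def inner_diff_right right_diff_distrib sum_subtractf)
    qed
    ultimately show ?thesis using ev by metis
  qed
  \<comment> \<open>Testing against a coordinate vector extracts the equation of a single body. That
    vector is not centred, hence the extension to \<open>ev_all\<close>.\<close>
  have vi: "(\<Sum>j\<in>UNIV. m j * (v$i - v$j) / \<bar>x i - x j\<bar> ^ 3) = \<mu> * v$i" for i
  proof -
    let ?e = "axis i 1 :: real^'n"
    have "2 * h v ?e = (\<Sum>k\<in>UNIV. \<Sum>j\<in>UNIV. (c k j * (v$k - v$j)) * (?e$k - ?e$j))"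
      by (simp add: h_def sum_distrib_left mult.assoc)
    also have "\<dots> = 2 * (\<Sum>k\<in>UNIV. \<Sum>j\<in>UNIV. (c k j * (v$k - v$j)) * ?e$k)"
      by (rule sum_antisymmetric_pairs[where 'a = real, unfolded inner_real_def]) (metis c_sym minus_diff_eq mult_minus_right)
    also have "\<dots> = 2 * (\<Sum>k\<in>UNIV. if k = i then (\<Sum>j\<in>UNIV. c k j * (v$k - v$j)) else 0)"
      by (intro arg_cong[of _ _ "(*) 2"] sum.cong) (auto simp: axis_def)
    finally have "h v ?e = (\<Sum>j\<in>UNIV. c i j * (v$i - v$j))" by simp
    also have "\<dots> = m i * (\<Sum>j\<in>UNIV. m j * (v$i - v$j) / \<bar>x i - x j\<bar> ^ 3)"
      by (simp add: c_def sum_distrib_left mult_ac)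
    finally have "m i * (\<Sum>j\<in>UNIV. m j * (v$i - v$j) / \<bar>x i - x j\<bar> ^ 3) = \<mu> * g v ?e"
      using ev_all[of ?e] by simp
    also have "g v ?e = (\<Sum>k\<in>UNIV. if k = i then m k * v$k else 0)"
      unfolding g_def by (intro sum.cong) (auto simp: axis_def)
    finally show ?thesis using m[of i] by (simp add: mult.left_commute)
  qed
  \<comment> \<open>A constant centred vector is zero, because the total mass is positive.\<close>
  have "\<exists>a b. v$a < v$b"
  proof (rule ccontr)
    assume "\<not> ?thesis"
    then have const: "v$a = v$b" for a b by (meson linorder_neqE)
    obtain i where "v $ i \<noteq> 0" using \<open>v \<noteq> 0\<close> by (metis vec_eq_iff zero_index)
    moreover have "(\<Sum>j\<in>UNIV. m j * v$j) = (\<Sum>j\<in>UNIV. m j) * v$i"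
      unfolding sum_distrib_right by (intro sum.cong refl) (metis const)
    ultimately show False using v(1) M by (simp add: T_def)
  qed
  then obtain a b where ab: "v$a < v$b" by blast
  then have "x a \<noteq> x b" using inj by (auto simp: inj_eq)
  have "\<omega> \<le> \<mu>"
  \<comment> \<open>The comparison needs a pair on which \<open>x\<close> and the other eigenvector
    increase together. If \<open>x\<close> decreases from \<open>a\<close> to \<open>b\<close>, then
    \<open>- v\<close> and the reversed pair serve.\<close>
  proof (cases "x a < x b")
    case True
    then show ?thesis using eigenvalue_ge_of_monotone_eigenvector[of m x \<omega> "\<lambda>i. v$i"] m inj x vi ab by blast
  next
    case False
    then have "x b < x a" using \<open>x a \<noteq> x b\<close> by simp
    moreover have "(\<Sum>j\<in>UNIV. m j * (- v$i - - v$j) / \<bar>x i - x j\<bar> ^ 3) = \<mu> * - v$i" for i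
    proof -
      have "m j * (- v$i - - v$j) = - (m j * (v$i - v$j))" for j by (simp add: algebra_simps)
      then show ?thesis using vi[of i] by (simp only: minus_divide_left[symmetric] sum_negf mult_minus_right)
    qed
    ultimately show ?thesis
      using eigenvalue_ge_of_monotone_eigenvector[of m x \<omega> "\<lambda>i. - v$i" \<mu> b a] m inj x ab by simp
  qed
  have gy: "g ?y ?y = (\<Sum>i\<in>UNIV. m i * (y i)\<^sup>2)" by (simp add: g_def power2_eq_square)
  have "0 \<le> (\<Sum>i\<in>UNIV. m i * (y i)\<^sup>2)" by (intro sum_nonneg) (simp add: less_imp_le m)
  then have "\<omega> * (\<Sum>i\<in>UNIV. m i * (y i)\<^sup>2) \<le> \<mu> * g ?y ?y"
    unfolding gy by (intro mult_right_mono \<open>\<omega> \<le> \<mu>\<close>)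
  also have "\<dots> \<le> h ?y ?y" using min \<open>?y \<in> T\<close> by blast
  also have "\<dots> = (\<Sum>i\<in>UNIV. \<Sum>j\<in>UNIV. m i * m j / \<bar>x i - x j\<bar> ^ 3 * (y i - y j)\<^sup>2) / 2"
    by (simp add: h_def c_def power2_eq_square sum_divide_distrib)
  finally show ?thesis .
qed

section \<open>Derivatives of the potential\<close>

lemma sum_ordered_pairs:
  fixes c :: "'n::{finite,linorder} \<Rightarrow> 'n \<Rightarrow> real"
  assumes sym: "\<And>i j. c i j = c j i" and diag: "\<And>i. c i i = 0"
  shows "(\<Sum>(i, j) \<in> {(i, j). i < j}. c i j) = (\<Sum>i\<in>UNIV. \<Sum>j\<in>UNIV. c i j) / 2"
proof -
  let ?c = "\<lambda>(i, j). c i j"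
  have "(\<Sum>i\<in>UNIV. \<Sum>j\<in>UNIV. c i j) = sum ?c UNIV"
    by (simp add: sum.cartesian_product)
  also have "UNIV = ({(i, j). i < j} \<union> {(i, j). j < i}) \<union> {(i :: 'n, j). i = j}" by auto
  also have "sum ?c \<dots> = sum ?c ({(i, j). i < j} \<union> {(i, j). j < i}) + sum ?c {(i, j). i = j}"
    by (rule sum.union_disjoint) auto
  also have "sum ?c ({(i, j). i < j} \<union> {(i, j). j < i}) = sum ?c {(i, j). i < j} + sum ?c {(i, j). j < i}"
    by (rule sum.union_disjoint) auto
  also have "sum ?c {(i, j). i = j} = 0"
    by (rule sum.neutral) (use diag in auto)
  also have "sum ?c {(i, j). j < i} = sum ?c {(i, j). i < j}"
    by (rule sum.reindex_bij_witness[of _ prod.swap prod.swap]) (use sym in auto)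
  finally show ?thesis by simp
qed

text \<open>The diagonal terms are zero by \<open>x / 0 = 0\<close>, so the double sum over all
  pairs counts every unordered pair twice.\<close>

lemma potential_eq:
  "potential m q = (\<Sum>i\<in>UNIV. \<Sum>j\<in>UNIV. m i * m j / norm (q $ i - q $ j)) / 2"
  unfolding potential_def
  by (rule sum_ordered_pairs) (simp_all add: norm_minus_commute mult.commute)

lemma second_deriv_eq:
  fixes f D :: "real \<Rightarrow> real"
  assumes "\<forall>\<^sub>F t in nhds x. (f has_real_derivative D t) (at t)"
    and "(D has_real_derivative c) (at x)"
  shows "(deriv ^^ 2) f x = c"
proof -
  have "\<forall>\<^sub>F t in nhds x. deriv f t = D t"
    using assms(1) by eventually_elim (rule DERIV_imp_deriv)
  then have "deriv (deriv f) x = deriv D x" by (rule deriv_cong_ev) simp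
  then show ?thesis using DERIV_imp_deriv[OF assms(2)] by (simp add: numeral_2_eq_2)
qed

lemma has_real_derivative_norm:
  fixes w :: "real \<Rightarrow> 'a::real_inner"
  assumes w: "(w has_vector_derivative w') (at t)" and nz: "w t \<noteq> 0"
  shows "((\<lambda>t. norm (w t)) has_real_derivative (w t \<bullet> w') / norm (w t)) (at t)"
proof -
  have "((\<lambda>t. norm (w t)) has_derivative (\<lambda>h. (h *\<^sub>R w') \<bullet> sgn (w t))) (at t)"
    using has_derivative_compose[OF w[unfolded has_vector_derivative_def] has_derivative_norm[OF nz]] .
  then show ?thesis
    by (rule has_derivative_imp_has_field_derivative)
      (simp add: sgn_div_norm inner_commute divide_inverse)
qed

lemma has_real_derivative_inverse_norm:
  fixes w :: "real \<Rightarrow> 'a::real_inner"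
  assumes w: "(w has_vector_derivative w') (at t)" and nz: "w t \<noteq> 0"
  shows "((\<lambda>t. c / norm (w t)) has_real_derivative - c * (w t \<bullet> w') / norm (w t) ^ 3) (at t)"
  by (rule derivative_eq_intros has_real_derivative_norm[OF assms] refl)+
    (use nz in \<open>simp_all add: power3_eq_cube field_simps\<close>)

lemma has_real_derivative_inner_cube:
  fixes w v :: "real \<Rightarrow> 'a::real_inner"
  assumes w: "(w has_vector_derivative v t) (at t)" and v: "(v has_vector_derivative a) (at t)"
    and nz: "w t \<noteq> 0"
  shows "((\<lambda>t. (w t \<bullet> v t) / norm (w t) ^ 3) has_real_derivative
    (v t \<bullet> v t + w t \<bullet> a) / norm (w t) ^ 3 - 3 * (w t \<bullet> v t)\<^sup>2 / norm (w t) ^ 5) (at t)"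
proof -
  have "((\<lambda>t. w t \<bullet> v t) has_real_derivative (w t \<bullet> a + v t \<bullet> v t)) (at t)"
    using bounded_bilinear.has_vector_derivative[OF bounded_bilinear_inner w v]
    by (simp add: has_real_derivative_iff_has_vector_derivative)
  moreover have "((\<lambda>t. norm (w t) ^ 3) has_real_derivative (3 * norm (w t) * (w t \<bullet> v t))) (at t)"
    by (rule derivative_eq_intros has_real_derivative_norm[OF w nz] refl)+
      (use nz in \<open>simp add: power2_eq_square\<close>)
  ultimately show ?thesis
    by (rule DERIV_cong[OF DERIV_divide])
      (use nz in \<open>simp_all add: field_simps eval_nat_numeral\<close>)
qed

text \<open>For symmetric \<open>S\<close> this is the polarization of
  \<open>moment_of_inertia\<close>: \<open>2 * inertia_form m S q v\<close> is the derivative of the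
  moment of inertia at \<open>q\<close> along \<open>v\<close>.\<close>

definition inertia_form :: "('n::finite \<Rightarrow> real) \<Rightarrow> real^'d^'d \<Rightarrow> real^'d^'n \<Rightarrow> real^'d^'n \<Rightarrow> real" where
  "inertia_form m S v w = (\<Sum>i\<in>UNIV. m i * ((S *v v $ i) \<bullet> w $ i))"

lemma moment_of_inertia_eq: "moment_of_inertia m S q = inertia_form m S q q"
  by (simp add: moment_of_inertia_def inertia_form_def)

lemma linear_matrix_vec_nth: "linear (\<lambda>v. S *v v $ i)" for S :: "real^'a^'b"
  by (simp add: linear_iff matrix_vector_right_distrib matrix_vector_mult_scaleR)

lemma bilinear_inertia_form: "bilinear (inertia_form m S)"
  unfolding inertia_form_def
  by (intro bilinear_sum_forms bilinear_scaled_inner linear_vec_nth linear_matrix_vec_nth)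

lemma inertia_form_commute:
  assumes "transpose S = S"
  shows "inertia_form m S v w = inertia_form m S w v"
proof -
  have "(S *v x) \<bullet> y = (S *v y) \<bullet> x" for x y :: "real^'a"
    using dot_lmul_matrix[of y S x] assms by (metis inner_commute transpose_matrix_vector)
  then show ?thesis by (simp add: inertia_form_def)
qed

text \<open>The terms \<open>i = j\<close> vanish because \<open>0 / 0 = 0\<close>.\<close>

definition potential_slope :: "('n::finite \<Rightarrow> real) \<Rightarrow> real^'d^'n \<Rightarrow> real^'d^'n \<Rightarrow> real" where
  "potential_slope m q v = - (\<Sum>i\<in>UNIV. \<Sum>j\<in>UNIV.
     m i * m j * (((q $ i - q $ j) \<bullet> (v $ i - v $ j)) / norm (q $ i - q $ j) ^ 3)) / 2"

lemma potential_has_real_derivative: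
  fixes \<gamma> :: "real \<Rightarrow> real^'d^'n::{finite,linorder}"
  assumes \<gamma>: "(\<gamma> has_vector_derivative v) (at t)" and nc: "\<gamma> t \<notin> collisions"
  shows "((potential m \<circ> \<gamma>) has_real_derivative potential_slope m (\<gamma> t) v) (at t)"
proof -
  have d: "((\<lambda>t. \<gamma> t $ i - \<gamma> t $ j) has_vector_derivative (v $ i - v $ j)) (at t)" for i j
    by (intro has_vector_derivative_diff bounded_linear.has_vector_derivative[OF bounded_linear_vec_nth] \<gamma>)
  have "((\<lambda>t. m i * m j / norm (\<gamma> t $ i - \<gamma> t $ j)) has_real_derivative
     - (m i * m j * (((\<gamma> t $ i - \<gamma> t $ j) \<bullet> (v $ i - v $ j)) / norm (\<gamma> t $ i - \<gamma> t $ j) ^ 3))) (at t)" for i j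
  proof (cases "i = j")
    case False
    then have "\<gamma> t $ i - \<gamma> t $ j \<noteq> 0" using nc by (auto simp: collisions_def)
    from has_real_derivative_inverse_norm[OF d this] show ?thesis by simp
  qed simp
  then have "((\<lambda>t. (\<Sum>i\<in>UNIV. \<Sum>j\<in>UNIV. m i * m j / norm (\<gamma> t $ i - \<gamma> t $ j)) / 2) has_real_derivative
    (\<Sum>i\<in>UNIV. \<Sum>j\<in>UNIV. - (m i * m j * (((\<gamma> t $ i - \<gamma> t $ j) \<bullet> (v $ i - v $ j))
      / norm (\<gamma> t $ i - \<gamma> t $ j) ^ 3))) / 2) (at t)"
    by (intro DERIV_cdivide DERIV_sum)
  then show ?thesis by (simp add: potential_eq[abs_def] potential_slope_def o_def sum_negf)
qed

text \<open>The acceleration enters only linearly, through \<open>potential_slope\<close>, and is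
  evaluated later from the constraint; the rest is quadratic in the velocity.\<close>

lemma potential_slope_has_real_derivative:
  fixes \<gamma> \<gamma>' :: "real \<Rightarrow> real^'d^'n::{finite,linorder}"
  assumes \<gamma>: "(\<gamma> has_vector_derivative \<gamma>' t) (at t)" "(\<gamma>' has_vector_derivative a) (at t)"
    and nc: "\<gamma> t \<notin> collisions"
  shows "((\<lambda>t. potential_slope m (\<gamma> t) (\<gamma>' t)) has_real_derivative
     potential_slope m (\<gamma> t) a + (\<Sum>i\<in>UNIV. \<Sum>j\<in>UNIV. m i * m j *
       (3 * ((\<gamma> t $ i - \<gamma> t $ j) \<bullet> (\<gamma>' t $ i - \<gamma>' t $ j))\<^sup>2 / norm (\<gamma> t $ i - \<gamma> t $ j) ^ 5
        - (norm (\<gamma>' t $ i - \<gamma>' t $ j))\<^sup>2 / norm (\<gamma> t $ i - \<gamma> t $ j) ^ 3)) / 2) (at t)"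
proof -
  have d: "((\<lambda>t. \<gamma> t $ i - \<gamma> t $ j) has_vector_derivative (\<gamma>' t $ i - \<gamma>' t $ j)) (at t)"
    "((\<lambda>t. \<gamma>' t $ i - \<gamma>' t $ j) has_vector_derivative (a $ i - a $ j)) (at t)" for i j
    by (intro has_vector_derivative_diff bounded_linear.has_vector_derivative[OF bounded_linear_vec_nth] \<gamma>)+
  define c where "c i j = m i * m j * (((\<gamma>' t $ i - \<gamma>' t $ j) \<bullet> (\<gamma>' t $ i - \<gamma>' t $ j)
        + (\<gamma> t $ i - \<gamma> t $ j) \<bullet> (a $ i - a $ j)) / norm (\<gamma> t $ i - \<gamma> t $ j) ^ 3
       - 3 * ((\<gamma> t $ i - \<gamma> t $ j) \<bullet> (\<gamma>' t $ i - \<gamma>' t $ j))\<^sup>2 / norm (\<gamma> t $ i - \<gamma> t $ j) ^ 5)" for i j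
  have "((\<lambda>t. m i * m j * (((\<gamma> t $ i - \<gamma> t $ j) \<bullet> (\<gamma>' t $ i - \<gamma>' t $ j))
      / norm (\<gamma> t $ i - \<gamma> t $ j) ^ 3)) has_real_derivative c i j) (at t)" for i j
    unfolding c_def
  proof (cases "i = j")
    case False
    then have "\<gamma> t $ i - \<gamma> t $ j \<noteq> 0" using nc by (auto simp: collisions_def)
    from DERIV_cmult[OF has_real_derivative_inner_cube[OF d this]]
    show "((\<lambda>t. m i * m j * (((\<gamma> t $ i - \<gamma> t $ j) \<bullet> (\<gamma>' t $ i - \<gamma>' t $ j))
      / norm (\<gamma> t $ i - \<gamma> t $ j) ^ 3)) has_real_derivative m i * m j * (((\<gamma>' t $ i - \<gamma>' t $ j) \<bullet> (\<gamma>' t $ i - \<gamma>' t $ j)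
        + (\<gamma> t $ i - \<gamma> t $ j) \<bullet> (a $ i - a $ j)) / norm (\<gamma> t $ i - \<gamma> t $ j) ^ 3
       - 3 * ((\<gamma> t $ i - \<gamma> t $ j) \<bullet> (\<gamma>' t $ i - \<gamma>' t $ j))\<^sup>2 / norm (\<gamma> t $ i - \<gamma> t $ j) ^ 5)) (at t)" .
  qed simp
  then have "((\<lambda>t. potential_slope m (\<gamma> t) (\<gamma>' t)) has_real_derivative
      - (\<Sum>i\<in>UNIV. \<Sum>j\<in>UNIV. c i j) / 2) (at t)"
    unfolding potential_slope_def by (intro DERIV_cdivide DERIV_minus DERIV_sum)
  moreover have "- (\<Sum>i\<in>UNIV. \<Sum>j\<in>UNIV. c i j) / 2 = potential_slope m (\<gamma> t) a
    + (\<Sum>i\<in>UNIV. \<Sum>j\<in>UNIV. m i * m j *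
       (3 * ((\<gamma> t $ i - \<gamma> t $ j) \<bullet> (\<gamma>' t $ i - \<gamma>' t $ j))\<^sup>2 / norm (\<gamma> t $ i - \<gamma> t $ j) ^ 5
        - (norm (\<gamma>' t $ i - \<gamma>' t $ j))\<^sup>2 / norm (\<gamma> t $ i - \<gamma> t $ j) ^ 3)) / 2"
    unfolding potential_slope_def c_def add_divide_distrib[symmetric] sum_negf[symmetric] sum.distrib[symmetric]
    by (intro arg_cong[of _ _ "\<lambda>x. x / 2"] sum.cong refl)
      (simp only: power2_norm_eq_inner distrib_left right_diff_distrib add_divide_distrib
         diff_divide_distrib minus_diff_eq minus_add_distrib)
  ultimately show ?thesis by simp
qed

lemma open_Compl_collisions: "open (- collisions :: (real^'d^'n::finite) set)"
proof -
  have "(collisions :: (real^'d^'n) set) = (\<Union>(i, j)\<in>{(i, j). i \<noteq> j}. {q. q $ i = q $ j})"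
    by (auto simp: collisions_def)
  moreover have "closed \<dots>"
    by (intro closed_UN) (auto intro!: closed_Collect_eq continuous_intros)
  ultimately show ?thesis by (simp add: open_Compl)
qed

section \<open>The Hessian on the inertia sphere\<close>

text \<open>The second derivative of \<open>U + (lam / 2) I_S\<close> at \<open>q\<close>, with
  \<open>lam\<close> as Lagrange multiplier. It is defined for all pairs of vectors and agrees with
  \<open>hessian\<close> on tangent vectors at a critical point.\<close>

definition hessian_form ::
  "('n::finite \<Rightarrow> real) \<Rightarrow> real^'d^'d \<Rightarrow> real \<Rightarrow> real^'d^'n \<Rightarrow> real^'d^'n \<Rightarrow> real^'d^'n \<Rightarrow> real" where
  "hessian_form m S lam q v w = (\<Sum>i\<in>UNIV. \<Sum>j\<in>UNIV. m i * m j *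
       (3 * ((q $ i - q $ j) \<bullet> (v $ i - v $ j)) * ((q $ i - q $ j) \<bullet> (w $ i - w $ j)) / norm (q $ i - q $ j) ^ 5
        - ((v $ i - v $ j) \<bullet> (w $ i - w $ j)) / norm (q $ i - q $ j) ^ 3)) / 2
     + lam * inertia_form m S v w"

lemma bilinear_hessian_form: "bilinear (hessian_form m S lam q)"
proof -
  have d: "linear (\<lambda>v. u \<bullet> (v $ i - v $ j))" for i j and u :: "real^'a"
    by (simp add: linear_iff inner_diff_right inner_add_right right_diff_distrib)
  have split: "a * (3 * x * y / p - z / r) / 2 = (3 * a / p / 2) * (x \<bullet> y) + (- a / r / 2) * z"
    for a x y z p r :: real
    by (simp add: algebra_simps diff_divide_distrib)
  have eq: "hessian_form m S lam q = (\<lambda>v w. (\<Sum>i\<in>UNIV. \<Sum>j\<in>UNIV.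
       (3 * (m i * m j) / norm (q $ i - q $ j) ^ 5 / 2) *
         (((q $ i - q $ j) \<bullet> (v $ i - v $ j)) \<bullet> ((q $ i - q $ j) \<bullet> (w $ i - w $ j)))
        + (- (m i * m j) / norm (q $ i - q $ j) ^ 3 / 2) * ((v $ i - v $ j) \<bullet> (w $ i - w $ j)))
     + (\<Sum>i\<in>UNIV. (lam * m i) * ((S *v v $ i) \<bullet> w $ i)))"
    unfolding hessian_form_def inertia_form_def sum_distrib_left sum_divide_distrib
    by (intro ext arg_cong2[of _ _ _ _ "(+)"] sum.cong refl) (rule split, simp only: mult.assoc)
  show ?thesis
    unfolding eq
    by (intro bilinear_add_forms bilinear_sum_forms bilinear_scaled_inner d linear_vec_nth
        linear_vec_nth_diff linear_matrix_vec_nth)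
qed

lemma hessian_form_commute:
  assumes "transpose S = S"
  shows "hessian_form m S lam q v w = hessian_form m S lam q w v"
  unfolding hessian_form_def inertia_form_commute[OF assms, of m v w]
  by (intro arg_cong2[of _ _ _ _ "(+)"] arg_cong[of _ _ "\<lambda>x. x / 2"] sum.cong refl)
    (simp only: inner_commute mult_ac)

lemma has_vector_derivative_eventually_const:
  assumes "\<forall>\<^sub>F s in nhds t. f s = c"
  shows "(f has_vector_derivative 0) (at t)"
  using has_vector_derivative_cong_ev[where S = UNIV and f = f and g = "\<lambda>_. c" and x = t and f' = 0]
    assms eventually_nhds_x_imp_x[OF assms] by simp

lemma subspace_centred_configs: "subspace (centred_configs m)"
proof -
  have "(\<Sum>i\<in>UNIV. m i *\<^sub>R (c *\<^sub>R q $ i)) = c *\<^sub>R (\<Sum>i\<in>UNIV. m i *\<^sub>R q $ i)" for c and q :: "real^'a^'b"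
    by (simp add: scaleR_sum_right mult.commute)
  then show ?thesis
    by (simp add: subspace_def centred_configs_def scaleR_add_right sum.distrib del: scaleR_scaleR)
qed

text \<open>Differentiates both constraints along the curve. The conclusion holds on a neighbourhood
  of 0, so that it can be differentiated once more.\<close>

lemma sphere_curve_velocity:
  fixes q :: "real^'d^'n::finite"
  assumes S: "transpose S = S" and curve: "curve_through (collision_free_sphere m S) q \<gamma> \<gamma>'"
  shows "\<forall>\<^sub>F t in nhds 0. \<gamma>' t \<in> centred_configs m \<and> inertia_form m S (\<gamma> t) (\<gamma>' t) = 0"
proof -
  \<comment> \<open>For \<open>t\<close> close to 0 the curve stays on the sphere near
    \<open>t\<close> as well, so the constraint functions are locally constant there.\<close>
  have "\<forall>\<^sub>F t in nhds 0. \<forall>\<^sub>F s in nhds t.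
      \<gamma> s \<in> collision_free_sphere m S \<and> (\<gamma> has_vector_derivative \<gamma>' s) (at s)"
    using curve by (simp add: curve_through_def eventually_eventually)
  then show ?thesis
  proof eventually_elim
    fix t
    assume ev: "\<forall>\<^sub>F s in nhds t. \<gamma> s \<in> collision_free_sphere m S \<and> (\<gamma> has_vector_derivative \<gamma>' s) (at s)"
    then have d: "(\<gamma> has_vector_derivative \<gamma>' t) (at t)"
      using eventually_nhds_x_imp_x by blast
    have "((\<lambda>s. inertia_form m S (\<gamma> s) (\<gamma> s)) has_vector_derivative
        (inertia_form m S (\<gamma> t) (\<gamma>' t) + inertia_form m S (\<gamma>' t) (\<gamma> t))) (at t)"
      using bilinear_inertia_form[of m S] d
      by (intro bounded_bilinear.has_vector_derivative) (simp_all add: bilinear_conv_bounded_bilinear)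
    moreover have "\<forall>\<^sub>F s in nhds t. inertia_form m S (\<gamma> s) (\<gamma> s) = 1"
      using ev by eventually_elim
        (simp add: collision_free_sphere_def inertia_sphere_def moment_of_inertia_eq)
    then have "((\<lambda>s. inertia_form m S (\<gamma> s) (\<gamma> s)) has_vector_derivative 0) (at t)"
      by (rule has_vector_derivative_eventually_const)
    ultimately have inertia: "inertia_form m S (\<gamma> t) (\<gamma>' t) + inertia_form m S (\<gamma>' t) (\<gamma> t) = 0"
      by (rule vector_derivative_unique_at)
    have "((\<lambda>s. \<Sum>i\<in>UNIV. m i *\<^sub>R (\<gamma> s $ i)) has_vector_derivative
        (\<Sum>i\<in>UNIV. m i *\<^sub>R (\<gamma>' t $ i))) (at t)"
      by (intro has_vector_derivative_sum bounded_linear.has_vector_derivative[OF bounded_linear_scaleR_right]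
          bounded_linear.has_vector_derivative[OF bounded_linear_vec_nth] d)
    moreover have "\<forall>\<^sub>F s in nhds t. (\<Sum>i\<in>UNIV. m i *\<^sub>R (\<gamma> s $ i)) = 0"
      using ev by eventually_elim
        (simp add: collision_free_sphere_def inertia_sphere_def centred_configs_def)
    then have "((\<lambda>s. \<Sum>i\<in>UNIV. m i *\<^sub>R (\<gamma> s $ i)) has_vector_derivative 0) (at t)"
      by (rule has_vector_derivative_eventually_const)
    ultimately have "(\<Sum>i\<in>UNIV. m i *\<^sub>R (\<gamma>' t $ i)) = 0"
      by (blast intro: vector_derivative_unique_at)
    with inertia show "\<gamma>' t \<in> centred_configs m \<and> inertia_form m S (\<gamma> t) (\<gamma>' t) = 0"
      using inertia_form_commute[OF S, of m "\<gamma>' t" "\<gamma> t"] by (simp add: centred_configs_def)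
  qed
qed

lemma inertia_form_add_scaled:
  assumes "transpose S = S" "inertia_form m S q v = 0" "inertia_form m S q q = 1"
  shows "inertia_form m S (q + t *\<^sub>R v) (q + t *\<^sub>R v) = 1 + inertia_form m S v v * t\<^sup>2"
  using assms(2,3) inertia_form_commute[OF assms(1), of m v q]
  by (simp add: bilinear_ladd[OF bilinear_inertia_form] bilinear_radd[OF bilinear_inertia_form]
      bilinear_lmul[OF bilinear_inertia_form] bilinear_rmul[OF bilinear_inertia_form] power2_eq_square)

text \<open>The mixed term of \<open>I_S (q + t v)\<close> vanishes for tangent \<open>v\<close>, so
  the square root is the right scaling. The same curve later realizes tangent vectors and disproves
  local minimality.\<close>

lemma normalized_line_in_sphere:
  assumes S: "transpose S = S"
    and q: "q \<in> inertia_sphere m S" and v: "v \<in> centred_configs m" "inertia_form m S q v = 0"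
    and pos: "1 + inertia_form m S v v * t\<^sup>2 > 0"
  shows "(1 / sqrt (1 + inertia_form m S v v * t\<^sup>2)) *\<^sub>R (q + t *\<^sub>R v) \<in> inertia_sphere m S"
proof -
  let ?r = "1 + inertia_form m S v v * t\<^sup>2"
  have q1: "inertia_form m S q q = 1" and q0: "q \<in> centred_configs m"
    using q by (auto simp: inertia_sphere_def moment_of_inertia_eq)
  have "inertia_form m S ((1 / sqrt ?r) *\<^sub>R (q + t *\<^sub>R v)) ((1 / sqrt ?r) *\<^sub>R (q + t *\<^sub>R v))
     = (1 / sqrt ?r) * (1 / sqrt ?r) * ?r"
    unfolding bilinear_lmul[OF bilinear_inertia_form] bilinear_rmul[OF bilinear_inertia_form]
      inertia_form_add_scaled[OF S v(2) q1] by simp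
  also have "\<dots> = 1" using pos by (simp add: field_simps)
  finally have "inertia_form m S ((1 / sqrt ?r) *\<^sub>R (q + t *\<^sub>R v)) ((1 / sqrt ?r) *\<^sub>R (q + t *\<^sub>R v)) = 1" .
  moreover have "(1 / sqrt ?r) *\<^sub>R (q + t *\<^sub>R v) \<in> centred_configs m"
  proof -
    have "(\<Sum>i\<in>UNIV. m i *\<^sub>R (((1 / sqrt ?r) *\<^sub>R (q + t *\<^sub>R v)) $ i))
       = (1 / sqrt ?r) *\<^sub>R ((\<Sum>i\<in>UNIV. m i *\<^sub>R (q $ i)) + t *\<^sub>R (\<Sum>i\<in>UNIV. m i *\<^sub>R (v $ i)))"
      unfolding scaleR_sum_right sum.distrib[symmetric]
      by (intro sum.cong refl) (simp add: scaleR_add_right mult.commute mult.left_commute)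
    then show ?thesis using q0 v(1) by (simp add: centred_configs_def)
  qed
  ultimately show ?thesis by (simp add: inertia_sphere_def moment_of_inertia_eq)
qed

lemma tangent_space_sphere:
  fixes q :: "real^'d^'n::finite"
  assumes S: "transpose S = S" and psd: "\<And>v :: real^'d^'n. inertia_form m S v v \<ge> 0"
    and q: "q \<in> collision_free_sphere m S"
  shows "tangent_space (collision_free_sphere m S) q
    = {v \<in> centred_configs m. inertia_form m S q v = 0}"
proof (intro set_eqI iffI)
  fix v assume "v \<in> tangent_space (collision_free_sphere m S) q"
  then obtain \<gamma> \<gamma>' where c: "curve_through (collision_free_sphere m S) q \<gamma> \<gamma>'" and v: "v = \<gamma>' 0"
    by (auto simp: tangent_space_def)
  from eventually_nhds_x_imp_x[OF sphere_curve_velocity[OF S c]] c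
  show "v \<in> {v \<in> centred_configs m. inertia_form m S q v = 0}"
    by (simp add: v curve_through_def)
next
  fix v assume v: "v \<in> {v \<in> centred_configs m. inertia_form m S q v = 0}"
  \<comment> \<open>The line \<open>q + t v\<close>, rescaled back to the sphere.\<close>
  let ?c = "inertia_form m S v v"
  define k where "k = (\<lambda>t. 1 / sqrt (1 + ?c * t\<^sup>2))"
  define k' where "k' = (\<lambda>t. - ?c * t / ((1 + ?c * t\<^sup>2) * sqrt (1 + ?c * t\<^sup>2)))"
  define \<gamma> where "\<gamma> = (\<lambda>t. k t *\<^sub>R (q + t *\<^sub>R v))"
  define \<gamma>' where "\<gamma>' = (\<lambda>t. k t *\<^sub>R v + k' t *\<^sub>R (q + t *\<^sub>R v))"
  have pos: "1 + ?c * t\<^sup>2 > 0" for t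
    using psd[of v] by (simp add: add_pos_nonneg)
  have nz: "(1 + ?c * t\<^sup>2) * sqrt (1 + ?c * t\<^sup>2) \<noteq> 0" for t
    using pos[of t] by simp
  have k: "(k has_real_derivative k' t) (at t)" for t
    unfolding k_def k'_def
    by (rule derivative_eq_intros refl | use pos[of t] in \<open>simp add: field_simps\<close>)+
  have line: "((\<lambda>t. q + t *\<^sub>R v) has_vector_derivative v) (at t)" for t
    by (auto intro!: derivative_eq_intros)
  have \<gamma>: "(\<gamma> has_vector_derivative \<gamma>' t) (at t)" for t
    unfolding \<gamma>_def \<gamma>'_def by (rule has_vector_derivative_scaleR[OF k line])
  have 0: "k 0 = 1" "k' 0 = 0" by (simp_all add: k_def k'_def)
  have "curve_through (collision_free_sphere m S) q \<gamma> \<gamma>'"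
    unfolding curve_through_def
  proof (intro conjI)
    show "\<gamma> 0 = q" by (simp add: \<gamma>_def 0)
    have "isCont \<gamma> 0" using \<gamma> has_vector_derivative_continuous by blast
    then have "(\<gamma> \<longlongrightarrow> q) (nhds 0)" using \<open>\<gamma> 0 = q\<close> by (simp add: isCont_def tendsto_nhds_iff)
    then have "\<forall>\<^sub>F t in nhds 0. \<gamma> t \<in> - collisions"
      using q by (intro topological_tendstoD open_Compl_collisions) (auto simp: collision_free_sphere_def)
    moreover have "\<gamma> t \<in> inertia_sphere m S" for t
      unfolding \<gamma>_def k_def
      by (rule normalized_line_in_sphere) (use S q v pos in \<open>auto simp: collision_free_sphere_def\<close>)
    ultimately show "\<forall>\<^sub>F t in nhds 0. \<gamma> t \<in> collision_free_sphere m S \<and> (\<gamma> has_vector_derivative \<gamma>' t) (at t)"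
      using \<gamma> by (simp add: collision_free_sphere_def)
    have "k differentiable (at 0)" using k unfolding real_differentiable_def by blast
    moreover have "k' differentiable (at 0)"
    proof -
      have "(\<lambda>t. (1 + ?c * t\<^sup>2) * sqrt (1 + ?c * t\<^sup>2)) differentiable (at 0)"
        unfolding real_differentiable_def
        by (rule exI) (rule derivative_eq_intros refl | simp)+
      then show ?thesis
        unfolding k'_def by (intro differentiable_divide) (use nz in auto)
    qed
    ultimately show "\<gamma>' differentiable (at 0)"
      unfolding \<gamma>'_def by (intro differentiable_add differentiable_scaleR) auto
  qed
  moreover have "\<gamma>' 0 = v" by (simp add: \<gamma>'_def 0)
  ultimately show "v \<in> tangent_space (collision_free_sphere m S) q"
    by (auto simp: tangent_space_def)
qed

text \<open>Differentiating \<open>inertia_form m S (\<gamma> t) (\<gamma>' t) = 0\<close> at 0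
  gives \<open>inertia_form m S q a = - inertia_form m S v v\<close> for the acceleration
  \<open>a\<close>. By \<open>crit\<close> the slope along \<open>a\<close> is then
  \<open>lam * inertia_form m S v v\<close>, and the choice of the curve drops out.\<close>

lemma hessian_quad_potential:
  fixes q :: "real^'d^'n::{finite,linorder}"
  assumes S: "transpose S = S"
    and crit: "\<And>v. potential_slope m q v = - lam * inertia_form m S q v"
    and v: "v \<in> tangent_space (collision_free_sphere m S) q"
  shows "hessian_quad (potential m) (collision_free_sphere m S) q v = hessian_form m S lam q v v"
proof -
  let ?M = "collision_free_sphere m S"
  have *: "(deriv ^^ 2) (potential m \<circ> \<gamma>) 0 = hessian_form m S lam q (\<gamma>' 0) (\<gamma>' 0)"
    if c: "curve_through ?M q \<gamma> \<gamma>'" for \<gamma> \<gamma>'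
  proof -
    have ev: "\<forall>\<^sub>F t in nhds 0. \<gamma> t \<in> ?M \<and> (\<gamma> has_vector_derivative \<gamma>' t) (at t)" and \<gamma>0: "\<gamma> 0 = q"
      using c by (simp_all add: curve_through_def)
    obtain a where a: "(\<gamma>' has_vector_derivative a) (at 0)"
      using c vector_derivative_works unfolding curve_through_def by blast
    have g0: "(\<gamma> has_vector_derivative \<gamma>' 0) (at 0)" and M0: "\<gamma> 0 \<in> ?M"
      using eventually_nhds_x_imp_x[OF ev] by auto
    then have nc: "\<gamma> 0 \<notin> collisions" by (simp add: collision_free_sphere_def)
    have "((\<lambda>t. inertia_form m S (\<gamma> t) (\<gamma>' t)) has_vector_derivative
        (inertia_form m S (\<gamma> 0) a + inertia_form m S (\<gamma>' 0) (\<gamma>' 0))) (at 0)"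
      using bilinear_inertia_form[of m S] g0 a
      by (intro bounded_bilinear.has_vector_derivative) (simp_all add: bilinear_conv_bounded_bilinear)
    moreover have ev0: "\<forall>\<^sub>F t in nhds 0. inertia_form m S (\<gamma> t) (\<gamma>' t) = 0"
      using sphere_curve_velocity[OF S c] by eventually_elim simp
    then have "((\<lambda>t. inertia_form m S (\<gamma> t) (\<gamma>' t)) has_vector_derivative 0) (at 0)"
      by (rule has_vector_derivative_eventually_const)
    ultimately have "inertia_form m S q a + inertia_form m S (\<gamma>' 0) (\<gamma>' 0) = 0"
      unfolding \<gamma>0 by (rule vector_derivative_unique_at)
    then have slope: "potential_slope m q a = lam * inertia_form m S (\<gamma>' 0) (\<gamma>' 0)"
      unfolding crit by (simp add: add_eq_0_iff)
    show ?thesis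
    proof (rule second_deriv_eq)
      show "\<forall>\<^sub>F t in nhds 0. (potential m \<circ> \<gamma> has_real_derivative potential_slope m (\<gamma> t) (\<gamma>' t)) (at t)"
        using ev by eventually_elim
          (rule potential_has_real_derivative, auto simp: collision_free_sphere_def)
      show "((\<lambda>t. potential_slope m (\<gamma> t) (\<gamma>' t)) has_real_derivative
          hessian_form m S lam q (\<gamma>' 0) (\<gamma>' 0)) (at 0)"
        using potential_slope_has_real_derivative[OF g0 a nc, of m, unfolded power2_norm_eq_inner]
        by (simp add: \<gamma>0 slope hessian_form_def power2_eq_square mult.assoc add.commute)
    qed
  qed
  \<comment> \<open>\<open>THE\<close> also requires uniqueness: without a curve of velocity
    \<open>v\<close> every number would satisfy the condition.\<close>
  obtain \<gamma> \<gamma>' where "curve_through ?M q \<gamma> \<gamma>'" "\<gamma>' 0 = v"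
    using v by (auto simp: tangent_space_def)
  note curve = this
  show ?thesis
    unfolding hessian_quad_def
  proof (rule the_equality)
    fix c
    assume "\<forall>\<gamma> \<gamma>'. curve_through ?M q \<gamma> \<gamma>' \<and> \<gamma>' 0 = v \<longrightarrow> (deriv ^^ 2) (potential m \<circ> \<gamma>) 0 = c"
    then have "(deriv ^^ 2) (potential m \<circ> \<gamma>) 0 = c" using curve by blast
    then show "c = hessian_form m S lam q v v" using *[OF curve(1)] curve(2) by simp
  qed (use * in blast)
qed

text \<open>Polarization; the values at \<open>v + w\<close> and \<open>v - w\<close> are available
  because the tangent space is a subspace.\<close>

lemma hessian_potential:
  fixes q :: "real^'d^'n::{finite,linorder}"
  assumes S: "transpose S = S" and psd: "\<And>v :: real^'d^'n::{finite,linorder}. inertia_form m S v v \<ge> 0"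
    and q: "q \<in> collision_free_sphere m S"
    and crit: "\<And>v. potential_slope m q v = - lam * inertia_form m S q v"
    and v: "v \<in> tangent_space (collision_free_sphere m S) q"
    and w: "w \<in> tangent_space (collision_free_sphere m S) q"
  shows "hessian (potential m) (collision_free_sphere m S) q v w = hessian_form m S lam q v w"
proof -
  have T: "subspace (tangent_space (collision_free_sphere m S) q)"
    using subspace_centred_configs[of m] unfolding tangent_space_sphere[OF S psd q] subspace_def
    by (auto simp: bilinear_radd[OF bilinear_inertia_form] bilinear_rmul[OF bilinear_inertia_form]
        bilinear_rzero[OF bilinear_inertia_form])
  show ?thesis
    unfolding hessian_def
      hessian_quad_potential[OF S crit subspace_add[OF T v w]]
      hessian_quad_potential[OF S crit subspace_diff[OF T v w]]
      bilinear_ladd[OF bilinear_hessian_form] bilinear_radd[OF bilinear_hessian_form]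
      bilinear_lsub[OF bilinear_hessian_form] bilinear_rsub[OF bilinear_hessian_form]
    using hessian_form_commute[OF S, of m lam q v w] by simp
qed

section \<open>Collinear balanced configurations\<close>

lemma diag_matrix_vec_nth: "(diag_matrix s *v x) $ k = s k * x $ k"
  by (simp add: diag_matrix_def matrix_vector_mult_def if_distrib[of "\<lambda>a. a * _"] cong: if_cong)

lemma transpose_diag_matrix: "transpose (diag_matrix s) = diag_matrix s"
  by (auto simp: diag_matrix_def transpose_def vec_eq_iff)

lemma inertia_form_diag:
  "inertia_form m (diag_matrix s) v w = (\<Sum>i\<in>UNIV. m i * (\<Sum>l\<in>UNIV. s l * v $ i $ l * w $ i $ l))"
  by (simp add: inertia_form_def inner_vec_def diag_matrix_vec_nth)

lemma inertia_form_diag_pos: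
  fixes v :: "real^'d^'n::finite"
  assumes m: "\<And>i. m i > 0" and s: "\<And>l. s l > 0" and v: "v \<noteq> 0"
  shows "inertia_form m (diag_matrix s) v v > 0"
proof -
  have nonneg: "0 \<le> s l * v $ i $ l * v $ i $ l" for i l
    using s[of l] by (simp add: mult.assoc)
  obtain i l where il: "v $ i $ l \<noteq> 0" using v by (metis vec_eq_iff zero_index)
  have "0 < (\<Sum>l\<in>UNIV. s l * v $ i $ l * v $ i $ l)"
    by (rule sum_pos2[of _ l])
      (use nonneg s[of l] il in \<open>auto simp: mult.assoc zero_less_mult_iff linorder_neq_iff\<close>)
  moreover have "0 \<le> m j * (\<Sum>l\<in>UNIV. s l * v $ j $ l * v $ j $ l)" for j
    using m[of j] nonneg by (simp add: sum_nonneg)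
  ultimately show ?thesis
    unfolding inertia_form_diag using m[of i] by (intro sum_pos2[of _ i]) auto
qed

text \<open>Along \<open>q + t v\<close> the explicit slope and the gradient give the same
  derivative. The gradient is the full one, so \<open>v\<close> ranges over all configurations and
  not only over tangent vectors.\<close>

lemma balanced_config_critical:
  fixes q :: "real^'d^'n::{finite,linorder}"
  assumes "balanced_config m S q"
  obtains lam where "lam > 0" "\<And>v. potential_slope m q v = - lam * inertia_form m S q v"
proof -
  obtain lam g where lam: "lam > 0" and g: "GDERIV (potential m) q :> g"
    and eq: "\<And>i. g $ i + (lam * m i) *\<^sub>R (S *v (q $ i)) = 0"
    using assms unfolding balanced_config_def by blast
  have "potential_slope m q v = - lam * inertia_form m S q v" for v
  proof -
    have line: "((\<lambda>t. q + t *\<^sub>R v) has_vector_derivative v) (at 0)"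
      by (auto intro!: derivative_eq_intros)
    have "(potential m \<circ> (\<lambda>t. q + t *\<^sub>R v) has_real_derivative potential_slope m q v) (at 0)"
      using potential_has_real_derivative[OF line, of m] assms by (simp add: balanced_config_def)
    moreover have "(potential m \<circ> (\<lambda>t. q + t *\<^sub>R v) has_real_derivative v \<bullet> g) (at 0)"
    proof -
      have "(potential m has_derivative (\<lambda>h. h \<bullet> g)) (at (q + 0 *\<^sub>R v))"
        using g by (simp add: gderiv_def)
      from diff_chain_at[OF line[unfolded has_vector_derivative_def] this]
      show ?thesis
        by (rule has_derivative_imp_has_field_derivative) (simp add: o_def mult.commute)
    qed
    ultimately have "potential_slope m q v = v \<bullet> g" by (rule DERIV_unique)
    also have "\<dots> = - lam * inertia_form m S q v"
    proof -
      have gi: "g $ i = - ((lam * m i) *\<^sub>R (S *v (q $ i)))" for i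
        using eq[of i] by (simp add: eq_neg_iff_add_eq_0)
      have "v \<bullet> g = (\<Sum>i\<in>UNIV. - lam * (m i * ((S *v q $ i) \<bullet> v $ i)))"
        unfolding inner_vec_def[of v g] by (intro sum.cong refl) (simp add: gi inner_commute)
      then show ?thesis by (simp add: inertia_form_def sum_distrib_left)
    qed
    finally show ?thesis .
  qed
  with lam show thesis using that by blast
qed

text \<open>Varying body \<open>i\<close> alone, by \<open>axis i w\<close>, isolates the force on
  it; the common factor \<open>m i\<close> is then cancelled.\<close>

lemma critical_force_equation:
  fixes q :: "real^'d^'n::finite"
  assumes m: "\<And>i. m i > 0" and crit: "\<And>v. potential_slope m q v = - lam * inertia_form m S q v"
  shows "(\<Sum>j\<in>UNIV. (m j / norm (q $ i - q $ j) ^ 3) *\<^sub>R (q $ i - q $ j)) = lam *\<^sub>R (S *v q $ i)"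
    (is "?F = _")
proof -
  define c where "c i j = (m i * m j / norm (q $ i - q $ j) ^ 3) *\<^sub>R (q $ i - q $ j)" for i j
  have slope: "potential_slope m q v = - (\<Sum>i\<in>UNIV. \<Sum>j\<in>UNIV. c i j \<bullet> v $ i)" for v
  proof -
    have "potential_slope m q v = - (\<Sum>i\<in>UNIV. \<Sum>j\<in>UNIV. c i j \<bullet> (v $ i - v $ j)) / 2"
      by (simp add: potential_slope_def c_def)
    moreover have "(\<Sum>i\<in>UNIV. \<Sum>j\<in>UNIV. c i j \<bullet> (v $ i - v $ j)) = 2 * (\<Sum>i\<in>UNIV. \<Sum>j\<in>UNIV. c i j \<bullet> v $ i)"
    proof (rule sum_antisymmetric_pairs)
      fix i j
      show "c j i = - c i j"
        by (simp add: c_def norm_minus_commute mult.commute scaleR_diff_right)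
    qed
    ultimately show ?thesis by simp
  qed
  have "(\<Sum>j\<in>UNIV. c i j) \<bullet> w = (lam * m i) *\<^sub>R (S *v q $ i) \<bullet> w" for w
  proof -
    have "(\<Sum>j\<in>UNIV. c i j) \<bullet> w = (\<Sum>k\<in>UNIV. if k = i then (\<Sum>j\<in>UNIV. c k j \<bullet> w) else 0)"
      by (simp add: inner_sum_left)
    also have "\<dots> = (\<Sum>k\<in>UNIV. \<Sum>j\<in>UNIV. c k j \<bullet> axis i w $ k)"
      by (intro sum.cong refl) (auto simp: axis_def)
    also have "\<dots> = lam * inertia_form m S q (axis i w)"
      using crit[of "axis i w"] slope[of "axis i w"] by simp
    also have "inertia_form m S q (axis i w) = (\<Sum>k\<in>UNIV. if k = i then m k * ((S *v q $ k) \<bullet> w) else 0)"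
      unfolding inertia_form_def by (intro sum.cong refl) (auto simp: axis_def)
    finally show ?thesis by simp
  qed
  then have "(\<Sum>j\<in>UNIV. c i j) = (lam * m i) *\<^sub>R (S *v q $ i)"
    by (subst vector_eq_rdot[symmetric]) blast
  moreover have "(\<Sum>j\<in>UNIV. c i j) = m i *\<^sub>R ?F"
    by (simp add: c_def scaleR_sum_right)
  ultimately have eq: "m i *\<^sub>R ?F = m i *\<^sub>R (lam *\<^sub>R (S *v q $ i))" by (simp add: mult.commute)
  have "m i \<noteq> 0" using m[of i] by simp
  then show ?thesis using eq by (rule scaleR_left_imp_eq)
qed

text \<open>All forces point along the line of the bodies, so the force equation at a body away from
  the origin makes \<open>u\<close> an eigenvector of the diagonal matrix. As its entries are
  distinct, \<open>u\<close> has only one nonzero coordinate.\<close>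

lemma CSBC_on_axis:
  fixes q :: "real^'d^'n::{finite,linorder}"
  assumes m: "\<And>i. m i > 0" and s: "inj s" and q: "CSBC m (diag_matrix s) q"
  obtains k where "\<And>i. q $ i \<in> span {axis k 1}"
proof -
  obtain u where u: "u \<noteq> 0" "\<And>i. q $ i \<in> span {u}" and bal: "balanced_config m (diag_matrix s) q"
    using q unfolding CSBC_def by blast
  obtain lam where lam: "lam > 0"
    and crit: "\<And>v. potential_slope m q v = - lam * inertia_form m (diag_matrix s) q v"
    using balanced_config_critical[OF bal] by blast
  have "inertia_form m (diag_matrix s) q q = 1"
    using bal by (simp add: balanced_config_def moment_of_inertia_eq)
  then obtain i where "q $ i \<noteq> 0" by (force simp: inertia_form_def)
  moreover obtain a where a: "q $ i = a *\<^sub>R u" using u(2)[of i] by (auto simp: span_singleton)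
  ultimately have "a \<noteq> 0" by auto
  have "lam *\<^sub>R (diag_matrix s *v q $ i) \<in> span {u}"
    unfolding critical_force_equation[OF m crit, symmetric]
    by (intro span_sum span_scale span_diff u)
  then obtain b where b: "lam *\<^sub>R (diag_matrix s *v q $ i) = b *\<^sub>R u" by (auto simp: span_singleton)
  have sl: "s l = b / (lam * a)" if "u $ l \<noteq> 0" for l
  proof -
    have "lam * (s l * (a * u $ l)) = b * u $ l"
      using arg_cong[OF b, of "\<lambda>w. w $ l"] by (simp add: diag_matrix_vec_nth a)
    then show ?thesis using that lam \<open>a \<noteq> 0\<close> by (simp add: field_simps)
  qed
  obtain k where k: "u $ k \<noteq> 0" using u(1) by (metis vec_eq_iff zero_index)
  have "u $ l = 0" if "l \<noteq> k" for l
    using sl[of l] sl[OF k] that injD[OF s] by metis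
  then have "u = u $ k *\<^sub>R axis k 1" by (auto simp: vec_eq_iff axis_def)
  then have "u \<in> span {axis k 1}" by (metis span_base span_scale singletonI)
  then have "span {u} \<subseteq> span {axis k 1}" by (intro span_minimal) auto
  then show thesis using that u(2) by blast
qed

section \<open>Dimensions of spaces cut out by linear constraints\<close>

lemma dim_orthogonal_constraints:
  fixes C :: "'a::euclidean_space set"
  shows "dim {v. \<forall>c\<in>C. c \<bullet> v = 0} + dim C = DIM('a)"
proof -
  have "{v. \<forall>c\<in>C. c \<bullet> v = 0} = {v \<in> UNIV. \<forall>c\<in>span C. orthogonal c v}"
  proof (intro set_eqI iffI)
    fix v assume "v \<in> {v. \<forall>c\<in>C. c \<bullet> v = 0}"
    then show "v \<in> {v \<in> UNIV. \<forall>c\<in>span C. orthogonal c v}"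
      using orthogonal_to_span[of _ C v] by (simp add: orthogonal_def inner_commute)
  qed (simp add: orthogonal_def span_base)
  then show ?thesis
    using dim_subspace_orthogonal_to_vectors[of "span C" UNIV] by (simp add: subspace_UNIV)
qed

text \<open>Constraints are represented by their normal vectors: this one for coordinate
  \<open>l\<close> of the centre of mass, \<open>inertia_vector\<close> for the inertia sphere at
  \<open>q\<close>.\<close>

definition mass_vector :: "('n::finite \<Rightarrow> real) \<Rightarrow> 'd \<Rightarrow> real^'d^'n" where
  "mass_vector m l = (\<chi> i. m i *\<^sub>R axis l 1)"

definition inertia_vector :: "('n::finite \<Rightarrow> real) \<Rightarrow> real^'d^'d \<Rightarrow> real^'d^'n \<Rightarrow> real^'d^'n" where
  "inertia_vector m S q = (\<chi> i. m i *\<^sub>R (S *v q $ i))"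

lemma mass_vector_inner: "mass_vector m l \<bullet> v = (\<Sum>i\<in>UNIV. m i * v $ i $ l)"
  by (simp add: mass_vector_def inner_vec_def[of _ v] inner_axis')

lemma inertia_vector_inner: "inertia_vector m S q \<bullet> v = inertia_form m S q v"
  by (simp add: inertia_vector_def inner_vec_def[of _ v] inertia_form_def)

lemma centred_configs_iff: "v \<in> centred_configs m \<longleftrightarrow> (\<forall>l. mass_vector m l \<bullet> v = 0)"
  by (simp add: centred_configs_def mass_vector_inner vec_eq_iff)

text \<open>The \<open>d + 1\<close> normals are independent: the mass vectors are pairwise
  orthogonal, and \<open>q\<close> is orthogonal to all of them but not to the inertia
  vector.\<close>

lemma dim_tangent_constraints:
  fixes q :: "real^'d^'n::finite"
  assumes m: "\<And>i. m i > 0" and q: "q \<in> centred_configs m" "inertia_form m S q q = 1"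
  shows "dim {v \<in> centred_configs m. inertia_form m S q v = 0} + (CARD('d) + 1) = CARD('n) * CARD('d)"
proof -
  let ?A = "range (mass_vector m :: 'd \<Rightarrow> real^'d^'n)"
  have orth: "mass_vector m l \<bullet> (mass_vector m l' :: real^'d^'n) = 0" if "l \<noteq> l'" for l l' :: 'd
    using that by (simp add: mass_vector_inner) (simp add: mass_vector_def axis_def)
  have nz: "mass_vector m l \<noteq> (0 :: real^'d^'n)" for l :: 'd
    using m by (auto simp: mass_vector_def vec_eq_iff axis_def) (metis less_irrefl)
  have "inj (mass_vector m :: 'd \<Rightarrow> real^'d^'n)"
  proof (rule injI, rule ccontr)
    fix l l' :: 'd
    assume "mass_vector m l = (mass_vector m l' :: real^'d^'n)" "l \<noteq> l'"
    then have "mass_vector m l \<bullet> (mass_vector m l :: real^'d^'n) = 0" using orth[of l l'] by simp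
    then show False using nz by simp
  qed
  moreover have "independent ?A"
  proof (rule pairwise_orthogonal_independent)
    show "pairwise orthogonal ?A"
    proof (rule pairwiseI)
      fix x y assume "x \<in> ?A" "y \<in> ?A" "x \<noteq> y"
      then obtain l l' where "x = mass_vector m l" "y = mass_vector m l'" "l \<noteq> l'" by auto
      then show "orthogonal x y" using orth by (simp add: orthogonal_def)
    qed
  qed (use nz in force)
  ultimately have "dim ?A = CARD('d)"
    by (simp add: dim_eq_card_independent card_image)
  moreover have "inertia_vector m S q \<notin> span ?A"
  proof
    assume "inertia_vector m S q \<in> span ?A"
    then have "orthogonal q (inertia_vector m S q)"
      by (rule orthogonal_to_span) (use q(1) in \<open>auto simp: centred_configs_iff orthogonal_def inner_commute\<close>)
    then show False using q(2) inertia_vector_inner[of m S q q] by (simp add: orthogonal_def inner_commute)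
  qed
  ultimately have "dim (insert (inertia_vector m S q) ?A) = CARD('d) + 1"
    by (simp add: dim_insert)
  moreover have "{v \<in> centred_configs m. inertia_form m S q v = 0}
      = {v. \<forall>c\<in>insert (inertia_vector m S q) ?A. c \<bullet> v = 0}"
    by (auto simp: centred_configs_iff inertia_vector_inner)
  ultimately show ?thesis
    using dim_orthogonal_constraints[of "insert (inertia_vector m S q) ?A"] by simp
qed

text \<open>For a lower bound it is enough to count constraints: \<open>n (d - 1)\<close> vanishing
  coordinates and two more normals, out of \<open>n d\<close> dimensions.\<close>

lemma dim_axis_directions_ge:
  fixes q :: "real^'d^'n::finite" and k :: 'd
  shows "CARD('n) \<le> dim {v :: real^'d^'n. (\<forall>i l. l \<noteq> k \<longrightarrow> v $ i $ l = 0) \<and>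
      mass_vector m k \<bullet> v = 0 \<and> inertia_form m S q v = 0} + 2"
proof -
  let ?B = "(\<lambda>(i, l). axis i (axis l 1) :: real^'d^'n) ` (UNIV \<times> (UNIV - {k}))"
  let ?C = "{mass_vector m k, inertia_vector m S q} \<union> ?B"
  have "card ?B \<le> card ((UNIV :: 'n set) \<times> (UNIV - {k} :: 'd set))" by (rule card_image_le) simp
  also have "\<dots> = CARD('n) * (CARD('d) - 1)" by (simp add: card_cartesian_product card_Diff_singleton)
  finally have B: "card ?B \<le> CARD('n) * (CARD('d) - 1)" .
  have "dim ?C \<le> card ?C" by (rule dim_le_card') simp
  also have "\<dots> \<le> card {mass_vector m k, inertia_vector m S q} + card ?B" by (rule card_Un_le)
  also have "\<dots> \<le> 2 + CARD('n) * (CARD('d) - 1)"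
    using B by (intro add_mono) (simp_all add: card_insert_if)
  finally have C: "dim ?C \<le> 2 + CARD('n) * (CARD('d) - 1)" .
  have "{v :: real^'d^'n. (\<forall>i l. l \<noteq> k \<longrightarrow> v $ i $ l = 0) \<and>
      mass_vector m k \<bullet> v = 0 \<and> inertia_form m S q v = 0} = {v. \<forall>c\<in>?C. c \<bullet> v = 0}"
    by (auto simp: inertia_vector_inner inner_axis')
  moreover have "CARD('n) * CARD('d) = CARD('n) * (CARD('d) - 1) + CARD('n)"
    by (simp add: diff_mult_distrib2)
  ultimately show ?thesis
    using dim_orthogonal_constraints[of ?C] C by simp
qed

text \<open>Here there are \<open>n\<close> vanishing coordinates and \<open>d - 1\<close> mass
  constraints, and \<open>n d - n - (d - 1) = (d - 1) (n - 1)\<close>.\<close>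

lemma dim_normal_directions_ge:
  fixes k :: "'d::finite"
  shows "(CARD('d) - 1) * (CARD('n) - 1) \<le> dim {v :: real^'d^'n::finite. (\<forall>i. v $ i $ k = 0) \<and>
      (\<forall>l. l \<noteq> k \<longrightarrow> mass_vector m l \<bullet> v = 0)}"
proof -
  let ?A = "mass_vector m ` (UNIV - {k}) :: (real^'d^'n) set"
  let ?B = "range (\<lambda>i. axis i (axis k 1) :: real^'d^'n)"
  have "dim (?A \<union> ?B) \<le> card (?A \<union> ?B)" by (rule dim_le_card') simp
  also have "\<dots> \<le> card ?A + card ?B" by (rule card_Un_le)
  also have "\<dots> \<le> card (UNIV - {k}) + CARD('n)" by (intro add_mono card_image_le) simp_all
  also have "\<dots> = (CARD('d) - 1) + CARD('n)" by (simp add: card_Diff_singleton)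
  finally have C: "dim (?A \<union> ?B) \<le> (CARD('d) - 1) + CARD('n)" .
  have "{v :: real^'d^'n. (\<forall>i. v $ i $ k = 0) \<and> (\<forall>l. l \<noteq> k \<longrightarrow> mass_vector m l \<bullet> v = 0)}
      = {v. \<forall>c\<in>?A \<union> ?B. c \<bullet> v = 0}"
    by (auto simp: inner_axis' ball_Un)
  moreover have "CARD('n) * CARD('d) = (CARD('d) - 1) * (CARD('n) - 1) + ((CARD('d) - 1) + CARD('n))"
    using zero_less_card_finite[where 'a = 'd] zero_less_card_finite[where 'a = 'n]
    by (cases "CARD('d)"; cases "CARD('n)") auto
  ultimately show ?thesis
    using dim_orthogonal_constraints[of "?A \<union> ?B"] C by simp
qed

text \<open>The axis \<open>k\<close> is arbitrary; the order of the entries of \<open>s\<close>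
  enters only through the extra assumptions of single lemmas that compare \<open>s k\<close> with
  other entries.\<close>

locale axis_balanced_config =
  fixes m :: "'n::{finite,linorder} \<Rightarrow> real"
    and s :: "'d::finite \<Rightarrow> real"
    and q :: "real^'d^'n::{finite,linorder}"
    and k :: 'd
    and lam :: real
  assumes m: "\<And>i. m i > 0" and s: "\<And>l. s l > 0" and lam: "lam > 0"
    and sphere: "q \<in> collision_free_sphere m (diag_matrix s)"
    and crit: "\<And>v. potential_slope m q v = - lam * inertia_form m (diag_matrix s) q v"
    and axis: "\<And>i. q $ i \<in> span {axis k 1}"
begin

abbreviation "S \<equiv> diag_matrix s"
abbreviation "M \<equiv> collision_free_sphere m S"
abbreviation "T \<equiv> {v \<in> centred_configs m. inertia_form m S q v = 0}"
abbreviation "H \<equiv> hessian_form m S lam q"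

definition x :: "'n \<Rightarrow> real" where "x i = q $ i $ k"

lemma position: "q $ i = x i *\<^sub>R axis k 1"
  using axis[of i] by (auto simp: span_singleton x_def)

lemma difference: "q $ i - q $ j = (x i - x j) *\<^sub>R axis k 1"
  by (simp add: position scaleR_diff_left)

lemma distance: "norm (q $ i - q $ j) = \<bar>x i - x j\<bar>"
  by (simp add: difference)

lemma off_axis: "l \<noteq> k \<Longrightarrow> q $ i $ l = 0"
  by (simp add: position axis_def)

lemma inj_x: "inj x"
proof (rule injI)
  fix i j assume "x i = x j"
  then have "q $ i = q $ j" by (simp add: position)
  then show "i = j" using sphere by (auto simp: collision_free_sphere_def collisions_def)
qed

lemma centred: "q \<in> centred_configs m" and normalized: "inertia_form m S q q = 1"
  using sphere by (auto simp: collision_free_sphere_def inertia_sphere_def moment_of_inertia_eq)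

lemma centred_x: "(\<Sum>i\<in>UNIV. m i * x i) = 0"
  using centred by (simp add: centred_configs_iff mass_vector_inner x_def)

lemma inertia_form_q: "inertia_form m S q v = s k * (\<Sum>i\<in>UNIV. m i * x i * v $ i $ k)"
proof -
  have "(\<Sum>l\<in>UNIV. s l * q $ i $ l * v $ i $ l) = s k * x i * v $ i $ k" for i
    by (subst sum.mono_neutral_right[of UNIV "{k}"]) (auto simp: off_axis x_def)
  then show ?thesis
    unfolding inertia_form_diag by (simp add: sum_distrib_left mult_ac)
qed

lemma normalized_x: "s k * (\<Sum>i\<in>UNIV. m i * (x i)\<^sup>2) = 1"
  using normalized inertia_form_q[of q] by (simp add: power2_eq_square mult.assoc flip: x_def)

text \<open>Coordinate \<open>k\<close> of the force equation. It supplies the eigenvector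
  \<open>x\<close>, with eigenvalue \<open>lam * s k\<close>, for the spectral gap.\<close>

lemma force: "(\<Sum>j\<in>UNIV. m j * (x i - x j) / \<bar>x i - x j\<bar> ^ 3) = lam * s k * x i"
proof -
  have "(\<Sum>j\<in>UNIV. (m j / norm (q $ i - q $ j) ^ 3) *\<^sub>R (q $ i - q $ j)) $ k = (lam *\<^sub>R (S *v q $ i)) $ k"
    by (simp only: critical_force_equation[OF m crit])
  then show ?thesis
    by (simp add: distance diag_matrix_vec_nth flip: x_def)
qed

lemma inertia_form_nonneg: "inertia_form m S v v \<ge> 0"
  using inertia_form_diag_pos[OF m s, of v]
  by (cases "v = 0") (auto simp: bilinear_lzero[OF bilinear_inertia_form] less_imp_le)

lemma tangent_space_eq: "tangent_space M q = T"
  by (rule tangent_space_sphere[OF transpose_diag_matrix inertia_form_nonneg sphere])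

lemma subspace_tangent: "subspace T"
  using subspace_centred_configs[of m] unfolding subspace_def
  by (auto simp: bilinear_radd[OF bilinear_inertia_form] bilinear_rmul[OF bilinear_inertia_form]
      bilinear_rzero[OF bilinear_inertia_form])

lemma H_commute: "H v w = H w v"
  by (rule hessian_form_commute[OF transpose_diag_matrix])

lemma hessian_eigenspace_eq: "hessian_eigenspace (potential m) M q \<mu> = form_eigenspace H T \<mu>"
  using hessian_potential[OF transpose_diag_matrix inertia_form_nonneg sphere crit]
  unfolding hessian_eigenspace_def form_eigenspace_def tangent_space_eq by auto

lemma morse_index_eq:
  "morse_index (potential m) M q = dim (\<Union>\<mu>\<in>{\<mu>. \<mu> < 0}. form_eigenspace H T \<mu>)"
  unfolding morse_index_def hessian_eigenvalues_def hessian_eigenspace_eq mem_Collect_eq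
  by (rule sum_dim_form_eigenspaces) (rule H_commute)

lemma morse_coindex_eq:
  "morse_coindex (potential m) M q = dim (\<Union>\<mu>\<in>{\<mu>. \<mu> > 0}. form_eigenspace H T \<mu>)"
  unfolding morse_coindex_def hessian_eigenvalues_def hessian_eigenspace_eq mem_Collect_eq
  by (rule sum_dim_form_eigenspaces) (rule H_commute)

text \<open>All differences \<open>q $ i - q $ j\<close> point along axis \<open>k\<close>, so their
  inner products see only coordinate \<open>k\<close>, and two of the five powers of the distance
  cancel. The weight is \<open>3 - 1 = 2\<close> along the axis and \<open>- 1\<close> across
  it.\<close>

lemma H_eq: "H v v = (\<Sum>i\<in>UNIV. \<Sum>j\<in>UNIV. m i * m j / \<bar>x i - x j\<bar> ^ 3 *
     (3 * (v $ i $ k - v $ j $ k)\<^sup>2 - (\<Sum>l\<in>UNIV. (v $ i $ l - v $ j $ l)\<^sup>2))) / 2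
   + lam * inertia_form m S v v"
proof -
  have "m i * m j *
       (3 * ((q $ i - q $ j) \<bullet> (v $ i - v $ j)) * ((q $ i - q $ j) \<bullet> (v $ i - v $ j)) / norm (q $ i - q $ j) ^ 5
        - ((v $ i - v $ j) \<bullet> (v $ i - v $ j)) / norm (q $ i - q $ j) ^ 3)
     = m i * m j / \<bar>x i - x j\<bar> ^ 3 *
     (3 * (v $ i $ k - v $ j $ k)\<^sup>2 - (\<Sum>l\<in>UNIV. (v $ i $ l - v $ j $ l)\<^sup>2))" for i j
  proof -
    define r where "r = x i - x j"
    have 1: "(q $ i - q $ j) \<bullet> (v $ i - v $ j) = r * (v $ i $ k - v $ j $ k)"
      by (simp add: difference inner_axis' r_def)
    have 2: "(v $ i - v $ j) \<bullet> (v $ i - v $ j) = (\<Sum>l\<in>UNIV. (v $ i $ l - v $ j $ l)\<^sup>2)"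
      by (simp add: inner_vec_def[of "v $ i - v $ j"] power2_eq_square)
    have 3: "3 * (r * a) * (r * a) / \<bar>r\<bar> ^ 5 = 3 * a\<^sup>2 / \<bar>r\<bar> ^ 3" for a
    proof (cases "r = 0")
      case False
      have "3 * (r * a) * (r * a) = 3 * a\<^sup>2 * \<bar>r\<bar> ^ 2"
        by (simp add: power2_eq_square)
      moreover have "\<bar>r\<bar> ^ 5 = \<bar>r\<bar> ^ 3 * \<bar>r\<bar> ^ 2" using power_add[of "\<bar>r\<bar>" 3 2] by simp
      ultimately show ?thesis using False by (simp only:) simp
    qed simp
    show ?thesis
      unfolding 1 2 3 distance r_def[symmetric] by (simp add: diff_divide_distrib[symmetric])
  qed
  then show ?thesis by (simp add: hessian_form_def)
qed

lemma H_pos_along_axis: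
  assumes "v \<noteq> 0" and v: "\<And>i l. l \<noteq> k \<Longrightarrow> v $ i $ l = 0"
  shows "H v v > 0"
proof -
  have "(\<Sum>l\<in>UNIV. (v $ i $ l - v $ j $ l)\<^sup>2) = (v $ i $ k - v $ j $ k)\<^sup>2" for i j
    by (subst sum.mono_neutral_right[of UNIV "{k}"]) (auto simp: v)
  moreover have "0 \<le> m i * m j / \<bar>x i - x j\<bar> ^ 3 * (2 * (v $ i $ k - v $ j $ k)\<^sup>2)" for i j
    using m by (intro mult_nonneg_nonneg divide_nonneg_nonneg) (auto intro: less_imp_le)
  ultimately have "0 \<le> (\<Sum>i\<in>UNIV. \<Sum>j\<in>UNIV. m i * m j / \<bar>x i - x j\<bar> ^ 3 *
     (3 * (v $ i $ k - v $ j $ k)\<^sup>2 - (\<Sum>l\<in>UNIV. (v $ i $ l - v $ j $ l)\<^sup>2)))"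
    by (intro sum_nonneg) simp
  moreover have "lam * inertia_form m S v v > 0"
    using inertia_form_diag_pos[OF m s \<open>v \<noteq> 0\<close>] lam by simp
  ultimately show ?thesis unfolding H_eq by linarith
qed

lemma H_neg_normal_to_axis:
  assumes "v \<noteq> 0" and vk: "\<And>i. v $ i $ k = 0" and v: "v \<in> centred_configs m"
    and less: "\<And>l. l \<noteq> k \<Longrightarrow> s l < s k"
  shows "H v v < 0"
proof -
  define N where "N l = (\<Sum>i\<in>UNIV. m i * (v $ i $ l)\<^sup>2)" for l
  define B where "B l = (\<Sum>i\<in>UNIV. \<Sum>j\<in>UNIV. m i * m j / \<bar>x i - x j\<bar> ^ 3 * (v $ i $ l - v $ j $ l)\<^sup>2)" for l
  have "H v v = - (\<Sum>i\<in>UNIV. \<Sum>j\<in>UNIV. \<Sum>l\<in>UNIV. m i * m j / \<bar>x i - x j\<bar> ^ 3 * (v $ i $ l - v $ j $ l)\<^sup>2) / 2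
    + lam * (\<Sum>i\<in>UNIV. \<Sum>l\<in>UNIV. s l * (m i * (v $ i $ l)\<^sup>2))"
    unfolding H_eq inertia_form_diag
    by (simp add: vk sum_distrib_left sum_negf power2_eq_square mult_ac)
  also have "(\<Sum>i\<in>UNIV. \<Sum>j\<in>UNIV. \<Sum>l\<in>UNIV. m i * m j / \<bar>x i - x j\<bar> ^ 3 * (v $ i $ l - v $ j $ l)\<^sup>2)
    = (\<Sum>i\<in>UNIV. \<Sum>l\<in>UNIV. \<Sum>j\<in>UNIV. m i * m j / \<bar>x i - x j\<bar> ^ 3 * (v $ i $ l - v $ j $ l)\<^sup>2)"
    by (intro sum.cong refl sum.swap)
  also have "\<dots> = (\<Sum>l\<in>UNIV. B l)" unfolding B_def by (rule sum.swap)
  also have "(\<Sum>i\<in>UNIV. \<Sum>l\<in>UNIV. s l * (m i * (v $ i $ l)\<^sup>2)) = (\<Sum>l\<in>UNIV. s l * N l)"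
    unfolding N_def sum_distrib_left by (rule sum.swap)
  finally have H: "H v v = (\<Sum>l\<in>UNIV. lam * (s l * N l) - B l / 2)"
    by (simp add: sum_subtractf sum_distrib_left sum_divide_distrib)
  have gap: "lam * s k * N l \<le> B l / 2" for l
    unfolding N_def B_def
    by (rule collinear_spectral_gap[OF m inj_x force])
      (use v in \<open>simp add: centred_configs_iff mass_vector_inner\<close>)
  have N: "N l \<ge> 0" for l
    unfolding N_def by (intro sum_nonneg mult_nonneg_nonneg) (auto intro: less_imp_le m)
  have Nk: "N k = 0" by (simp add: N_def vk)
  \<comment> \<open>The form has split into coordinates, and the gap replaces each interaction term
    by a multiple of the mass norm. Strictness will come from a coordinate
    \<open>l \<noteq> k\<close> with \<open>N l > 0\<close>.\<close>
  have le: "lam * (s l * N l) - B l / 2 \<le> lam * (s l - s k) * N l" for l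
    using gap[of l] by (simp add: algebra_simps)
  have le0: "lam * (s l - s k) * N l \<le> 0" for l
  proof (cases "l = k")
    case False
    then have "lam * (s l - s k) \<le> 0" using less[of l] lam by (simp add: mult_le_0_iff)
    then show ?thesis using N by (rule mult_nonpos_nonneg)
  qed simp
  obtain i l where il: "v $ i $ l \<noteq> 0" using \<open>v \<noteq> 0\<close> by (metis vec_eq_iff zero_index)
  have "N l > 0"
    unfolding N_def
    by (rule sum_pos2[of _ i]) (use m il in \<open>simp_all add: less_imp_le\<close>)
  moreover have "l \<noteq> k" using il vk by metis
  then have "lam * (s l - s k) < 0" using less lam by (simp add: mult_less_0_iff)
  ultimately have "lam * (s l - s k) * N l < 0" by (simp only: mult_neg_pos)
  then have "lam * (s l * N l) - B l / 2 < 0" using le[of l] by linarith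
  then have "(\<Sum>l\<in>UNIV. lam * (s l * N l) - B l / 2) < (\<Sum>l\<in>(UNIV :: 'd set). 0)"
    using order_trans[OF le le0] by (intro sum_strict_mono_ex1 finite) blast+
  then show ?thesis by (simp add: H)
qed

lemma coindex_ge: "CARD('n) - 2 \<le> morse_coindex (potential m) M q"
proof -
  let ?W = "{v :: real^'d^'n::{finite,linorder}. (\<forall>i l. l \<noteq> k \<longrightarrow> v $ i $ l = 0) \<and>
      mass_vector m k \<bullet> v = 0 \<and> inertia_form m S q v = 0}"
  have "subspace ?W"
    by (auto simp: subspace_def inner_add_right bilinear_radd[OF bilinear_inertia_form]
        bilinear_rmul[OF bilinear_inertia_form] bilinear_rzero[OF bilinear_inertia_form])
  moreover have "?W \<subseteq> T"
  proof safe
    fix v :: "real^'d^'n::{finite,linorder}"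
    assume *: "\<forall>i l. l \<noteq> k \<longrightarrow> v $ i $ l = 0" "mass_vector m k \<bullet> v = 0"
    \<comment> \<open>A vector along axis \<open>k\<close> satisfies the centring conditions in the
      other coordinates automatically.\<close>
    then have "mass_vector m l \<bullet> v = 0" for l
      by (cases "l = k") (simp_all add: mass_vector_inner)
    then show "v \<in> centred_configs m" by (simp add: centred_configs_iff)
  qed
  ultimately have "dim ?W \<le> morse_coindex (potential m) M q"
    unfolding morse_coindex_eq
    by (rule dim_definite_le_eigenspaces_pos[OF bilinear_hessian_form H_commute subspace_tangent])
      (use H_pos_along_axis in blast)
  then show ?thesis using dim_axis_directions_ge[where k = k and m = m and S = S and q = q] by simp
qed

lemma index_coindex_le:
  "morse_index (potential m) M q + morse_coindex (potential m) M q + (CARD('d) + 1) \<le> CARD('n) * CARD('d)"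
  using dim_eigenspaces_neg_pos_le[of H T, OF H_commute]
    dim_tangent_constraints[OF m centred normalized]
  unfolding morse_index_eq morse_coindex_eq by linarith

lemma index_ge:
  assumes less: "\<And>l. l \<noteq> k \<Longrightarrow> s l < s k"
  shows "(CARD('d) - 1) * (CARD('n) - 1) \<le> morse_index (potential m) M q"
proof -
  let ?W = "{v :: real^'d^'n::{finite,linorder}. (\<forall>i. v $ i $ k = 0) \<and> (\<forall>l. l \<noteq> k \<longrightarrow> mass_vector m l \<bullet> v = 0)}"
  have "subspace ?W" by (auto simp: subspace_def inner_add_right)
  moreover have centred: "?W \<subseteq> centred_configs m"
  proof safe
    fix v :: "real^'d^'n::{finite,linorder}"
    assume *: "\<forall>i. v $ i $ k = 0" "\<forall>l. l \<noteq> k \<longrightarrow> mass_vector m l \<bullet> v = 0"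
    then have "mass_vector m l \<bullet> v = 0" for l
      by (cases "l = k") (simp_all add: mass_vector_inner)
    then show "v \<in> centred_configs m" by (simp add: centred_configs_iff)
  qed
  \<comment> \<open>Tangency to the sphere is automatic: \<open>inertia_form m S q\<close> depends
    only on the coordinates along \<open>k\<close>.\<close>
  then have "?W \<subseteq> T" by (auto simp: inertia_form_q)
  ultimately have "dim ?W \<le> morse_index (potential m) M q"
    unfolding morse_index_eq
    by (intro dim_definite_le_eigenspaces[OF bilinear_hessian_form H_commute subspace_tangent])
      (use H_neg_normal_to_axis less centred in blast)+
  then show ?thesis using dim_normal_directions_ge[where k = k and m = m] by (rule order_trans[rotated])
qed

lemma not_local_minimum:
  assumes card: "CARD('n) \<ge> 2" and e: "s e < s k"
  shows "\<not> local_minimum_on (potential m) M q"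
proof
  assume "local_minimum_on (potential m) M q"
  \<comment> \<open>Rotating the line of the bodies from axis \<open>k\<close> towards axis \<open>e\<close> decreases the potential.\<close>
  then obtain \<delta> where "\<delta> > 0"
    and min: "\<And>p. p \<in> M \<Longrightarrow> p \<noteq> q \<Longrightarrow> dist p q < \<delta> \<Longrightarrow> potential m q \<le> potential m p"
    by (auto simp: local_minimum_on_def eventually_at)
  have ek: "e \<noteq> k" using e by auto
  define v :: "real^'d^'n::{finite,linorder}" where "v = (\<chi> i. x i *\<^sub>R axis e 1)"
  define c where "c = inertia_form m S v v"
  define \<gamma> where "\<gamma> t = (1 / sqrt (1 + c * t\<^sup>2)) *\<^sub>R (q + t *\<^sub>R v)" for t
  \<comment> \<open>The vector \<open>v\<close> is a copy of \<open>q\<close> on axis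
    \<open>e\<close>, so the normalization of \<open>q\<close> gives \<open>c = s e / s k\<close>,
    which is below 1.\<close>
  have "c * s k = s e"
  proof -
    have "(\<Sum>l\<in>UNIV. s l * v $ i $ l * v $ i $ l) = s e * (x i)\<^sup>2" for i
      by (subst sum.mono_neutral_right[of UNIV "{e}"]) (auto simp: v_def axis_def power2_eq_square)
    then have "c = s e * (\<Sum>i\<in>UNIV. m i * (x i)\<^sup>2)"
      by (simp add: c_def inertia_form_diag sum_distrib_left mult_ac)
    then have "c * s k = s e * (s k * (\<Sum>i\<in>UNIV. m i * (x i)\<^sup>2))" by (simp add: mult_ac)
    then show ?thesis by (simp only: normalized_x)
  qed
  then have "c * s k < 1 * s k" using e by simp
  then have c1: "c < 1" using s[of k] by (simp only: mult_less_cancel_right_pos)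
  have c0: "c \<ge> 0" unfolding c_def by (rule inertia_form_nonneg)
  have r: "1 + c * t\<^sup>2 > 0" for t using c0 by (simp add: add_pos_nonneg)
  have vT: "v \<in> centred_configs m" "inertia_form m S q v = 0"
  proof -
    have "mass_vector m l \<bullet> v = 0" for l
      using centred_x by (cases "l = e") (simp_all add: mass_vector_inner v_def axis_def)
    then show "v \<in> centred_configs m" by (simp add: centred_configs_iff)
    show "inertia_form m S q v = 0" using ek by (simp add: inertia_form_q v_def axis_def)
  qed
  \<comment> \<open>All mutual distances change by one common factor, so the potential is divided by
    it; as \<open>c < 1\<close>, the factor exceeds 1 for \<open>t > 0\<close>.\<close>
  have dist: "norm (\<gamma> t $ i - \<gamma> t $ j) = norm (q $ i - q $ j) * (sqrt (1 + t\<^sup>2) / sqrt (1 + c * t\<^sup>2))" for t i j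
  proof -
    have "\<gamma> t $ i - \<gamma> t $ j = ((x i - x j) / sqrt (1 + c * t\<^sup>2)) *\<^sub>R (axis k 1 + t *\<^sub>R axis e 1)"
      by (simp add: \<gamma>_def v_def position algebra_simps diff_divide_distrib)
    moreover have "norm (axis k 1 + t *\<^sub>R axis e 1 :: real^'d) = sqrt (1 + t\<^sup>2)"
      using ek by (simp add: norm_eq_sqrt_inner inner_add_left inner_add_right inner_axis_axis power2_eq_square)
    ultimately show ?thesis using r[of t] by (simp add: distance abs_mult)
  qed
  have pot: "potential m (\<gamma> t) = potential m q * (sqrt (1 + c * t\<^sup>2) / sqrt (1 + t\<^sup>2))" for t
    unfolding potential_eq dist sum_divide_distrib sum_distrib_right by (simp add: mult_ac)
  have "potential m q > 0"
  proof -
    obtain i j :: 'n where "i < j"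
    proof -
      obtain i :: 'n where True by simp
      have "(UNIV :: 'n set) \<noteq> {i}"
      proof
        assume "(UNIV :: 'n set) = {i}"
        then have "CARD('n) = card {i}" by (rule arg_cong)
        then show False using card by simp
      qed
      then obtain j where "j \<noteq> i" by auto
      then show thesis using that[of i j] that[of j i] by (meson linorder_neqE)
    qed
    moreover have "m i * m j / norm (q $ i - q $ j) > 0" if "i < j" for i j
      using that m inj_x by (simp add: distance inj_eq)
    ultimately show ?thesis
      unfolding potential_def by (intro sum_pos) auto
  qed
  then have smaller: "potential m (\<gamma> t) < potential m q" if "t > 0" for t
  proof -
    have "sqrt (1 + c * t\<^sup>2) < sqrt (1 + t\<^sup>2)" using c1 that by simp
    moreover have "sqrt (1 + t\<^sup>2) > 0" by (simp add: add_pos_nonneg)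
    ultimately have "sqrt (1 + c * t\<^sup>2) / sqrt (1 + t\<^sup>2) < 1" by simp
    from mult_strict_left_mono[OF this \<open>potential m q > 0\<close>] show ?thesis unfolding pot by simp
  qed
  have mem: "\<gamma> t \<in> M" for t
  proof -
    have "\<gamma> t \<in> inertia_sphere m S"
      unfolding \<gamma>_def c_def
      by (rule normalized_line_in_sphere[OF transpose_diag_matrix])
        (use sphere vT r in \<open>auto simp: collision_free_sphere_def c_def\<close>)
    moreover have "\<gamma> t \<notin> collisions"
    proof
      assume "\<gamma> t \<in> collisions"
      then obtain i j where "i \<noteq> j" "norm (\<gamma> t $ i - \<gamma> t $ j) = 0" by (auto simp: collisions_def)
      moreover have "sqrt (1 + t\<^sup>2) / sqrt (1 + c * t\<^sup>2) > 0" using r by (simp add: add_pos_nonneg)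
      ultimately show False using inj_x by (auto simp: dist distance inj_eq)
    qed
    ultimately show ?thesis by (simp add: collision_free_sphere_def)
  qed
  have "(\<gamma> \<longlongrightarrow> \<gamma> 0) (at_right 0)"
    unfolding \<gamma>_def using r by (auto intro!: tendsto_eq_intros)
  then have "\<forall>\<^sub>F t in at_right 0. dist (\<gamma> t) q < \<delta>"
    using \<open>\<delta> > 0\<close> by (simp add: tendsto_iff) (simp add: \<gamma>_def)
  moreover have "\<forall>\<^sub>F t in at_right 0. (t :: real) > 0" by (rule eventually_at_right_less)
  \<comment> \<open>The strict decrease of the potential also shows
    \<open>\<gamma> t \<noteq> q\<close>, as \<open>min\<close> demands.\<close>
  ultimately have "\<forall>\<^sub>F t in at_right (0 :: real). False"
    by eventually_elim (use min mem smaller in \<open>metis less_irrefl not_le\<close>)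
  then show False by simp
qed

end

theorem lemma2p13:
  fixes m :: "'n::{finite,linorder} \<Rightarrow> real"
    and s :: "'d::{finite,linorder} \<Rightarrow> real"
    and q :: "real^'d::{finite,linorder}^'n::{finite,linorder}"
  assumes "CARD('n) \<ge> 2" and "CARD('d) \<ge> 2"
    and "\<forall>i. m i > 0"
    and "\<forall>j k. j < k \<longrightarrow> s j > s k" and "s (Max UNIV) = 1"
    and "CSBC m (diag_matrix s) q"
  shows
    "(morse_index (potential m) (collision_free_sphere m (diag_matrix s)) q
        \<le> (CARD('d) - 1) * (CARD('n) - 1) \<and>
      morse_coindex (potential m) (collision_free_sphere m (diag_matrix s)) q
        \<ge> CARD('n) - 2) \<and>
     (axis_CSBC m (diag_matrix s) (Min UNIV) q \<longrightarrow>
      morse_index (potential m) (collision_free_sphere m (diag_matrix s)) q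
        = (CARD('d) - 1) * (CARD('n) - 1) \<and>
      morse_coindex (potential m) (collision_free_sphere m (diag_matrix s)) q
        = CARD('n) - 2) \<and>
     (\<forall>j. j < Max UNIV \<and> axis_CSBC m (diag_matrix s) j q \<longrightarrow>
      \<not> local_minimum_on (potential m) (collision_free_sphere m (diag_matrix s)) q)"
proof -
  have m: "\<And>i. m i > 0" using assms(3) by blast
  have s: "s l > 0" for l
  proof (cases "l = Max UNIV")
    case False
    then have "l < Max UNIV" by (simp add: order_less_le)
    then show ?thesis using assms(4,5) by force
  qed (simp add: assms(5))
  have inj: "inj s"
    using assms(4) by (metis injI linorder_neqE less_irrefl)
  have bal: "balanced_config m (diag_matrix s) q" using assms(6) by (simp add: CSBC_def)
  then obtain lam where lam: "lam > 0"
    and crit: "\<And>v. potential_slope m q v = - lam * inertia_form m (diag_matrix s) q v"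
    using balanced_config_critical by blast
  have sphere: "q \<in> collision_free_sphere m (diag_matrix s)"
    using bal by (simp add: balanced_config_def collision_free_sphere_def inertia_sphere_def)
  have on_axis: "axis_balanced_config m s q k lam" if "\<And>i. q $ i \<in> span {axis k 1}" for k
    by (rule axis_balanced_config.intro[OF m s lam sphere crit that])
  \<comment> \<open>The dimension of the tangent space splits exactly into the two claimed bounds.
    Writing the cardinalities as \<open>n + 2\<close> and \<open>d + 2\<close> removes the truncated
    subtractions.\<close>
  have arith: "CARD('n) * CARD('d) = (CARD('d) - 1) * (CARD('n) - 1) + (CARD('n) - 2) + (CARD('d) + 1)"
  proof -
    obtain n d where "CARD('n) = n + 2" "CARD('d) = d + 2"
      using assms(1,2) by (metis add.commute le_Suc_ex)
    then show ?thesis by simp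
  qed
  obtain k where k: "\<And>i. q $ i \<in> span {axis k 1}" using CSBC_on_axis[OF m inj assms(6)] by blast
  let ?index = "morse_index (potential m) (collision_free_sphere m (diag_matrix s)) q"
  let ?coindex = "morse_coindex (potential m) (collision_free_sphere m (diag_matrix s)) q"
  have coindex: "?coindex \<ge> CARD('n) - 2"
    by (rule axis_balanced_config.coindex_ge[OF on_axis[OF k]])
  have sum: "?index + ?coindex \<le> (CARD('d) - 1) * (CARD('n) - 1) + (CARD('n) - 2)"
    using axis_balanced_config.index_coindex_le[OF on_axis[OF k]] unfolding arith by simp
  \<comment> \<open>\<open>Min UNIV\<close> carries the largest entry of \<open>s\<close>. With
    \<open>coindex\<close> and \<open>sum\<close>, this bound leaves room only for equality in both
    counts.\<close>
  have min_axis: "?index \<ge> (CARD('d) - 1) * (CARD('n) - 1)" if "axis_CSBC m (diag_matrix s) (Min UNIV) q"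
  proof (rule axis_balanced_config.index_ge)
    show "axis_balanced_config m s q (Min UNIV) lam"
      using that by (intro on_axis) (simp add: axis_CSBC_def)
    fix l assume "l \<noteq> Min (UNIV :: 'd set)"
    then have "Min UNIV < l" by (simp add: order_less_le)
    then show "s l < s (Min UNIV)" using assms(4) by blast
  qed
  have no_min: "\<not> local_minimum_on (potential m) (collision_free_sphere m (diag_matrix s)) q"
    if "j < Max UNIV" "axis_CSBC m (diag_matrix s) j q" for j
  \<comment> \<open>The rotation goes towards axis \<open>Max UNIV\<close>, which carries the least
    entry of \<open>s\<close>.\<close>
  proof (rule axis_balanced_config.not_local_minimum)
    show "axis_balanced_config m s q j lam"
      using that by (intro on_axis) (simp add: axis_CSBC_def)
    show "s (Max UNIV) < s j" using assms(4) that by blast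
  qed (rule assms(1))
  have min_eq: "?index = (CARD('d) - 1) * (CARD('n) - 1) \<and> ?coindex = CARD('n) - 2"
    if "axis_CSBC m (diag_matrix s) (Min UNIV) q"
    using min_axis[OF that] coindex sum by linarith
  show ?thesis
  proof (intro conjI impI allI)
    show "?index \<le> (CARD('d) - 1) * (CARD('n) - 1)" using coindex sum by linarith
  qed (use coindex min_eq no_min in blast)+
qed

end
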